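(* Let $n\ge1$, $\sigma>0$, $\delta\in(0,1)$, and let $V:\mathbb R\times\mathbb T^n\to\mathbb R$ be $C^1$ in $(x,\theta)$ and such that, for each $x$, $V(x,\cdot)$ extends analytically to $\mathbb T^n_\sigma$. Assume that there is $C_0>0$ with $$|V(x,\theta)|\le C_0,\qquad |\partial_xV(x,\theta)|\le C_0(1+|x|)^\delta,\qquad\forall(x,\theta)\in\mathbb R\times\mathbb T^n_\sigma.$$ Then the matrix $\mathbb P(\theta)=(\mathbb P_i^j(\theta))_{i,j\in\mathbb N}$ defined by $$\mathbb P_i^j(\theta)=\int_{\mathbb R}V(x,\theta)h_i(x)h_j(x)\,dx$$ is real analytic in $\theta$, mapping $\mathbb T^n_\sigma$ to $\mathcal M_{\widehat\alpha}$ with $\alpha=\frac{1-\delta}2$.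
   Context: $\mathbb N=\{1,2,\dots\}$; $\mathbb T^n=\mathbb R^n/(2\pi\mathbb Z)^n$, $\mathbb T^n_\sigma=\{a+\mathbf i b\in\mathbb C^n/(2\pi\mathbb Z)^n:|b|<\sigma\}$. $h_i$ ($i\ge1$) are the $L^2(\mathbb R)$-normalized eigenfunctions of $-\frac{d^2}{dx^2}+x^2$, with eigenvalues $2i-1$ (Hermite basis). "Real analytic on $\mathbb T^n_\sigma$" means real-analytic on $\mathbb T^n$ with analytic extension to $\mathbb T^n_\sigma$. For an infinite complex matrix $A=(A_i^j)_{i,j\in\mathbb N}$ acting by $(Au)_i=\sum_jA_i^ju_j$, $\|A\|$ is the operator norm on $\ell^2$ and $\mathcal M=\mathcal B(\ell^2)$. The difference matrix is $(\Delta A)_i^j:=A_{i+1}^{j+1}-A_i^j$. With $i\wedge j=\min\{i,j\}$, $|A|_\alpha:=\sup_{i,j\ge1}(i\wedge j)^\alpha|A_i^j|$ and $\mathcal M_\alpha=\{A:|A|_\alpha<\infty\}$. $\mathcal M_{\widehat\alpha}:=\{A\in\mathcal M:\Delta A\in\mathcal M_\alpha\}$, with norm $\|A\|_{\widehat\alpha}:=\max\{\|A\|,|\Delta A|_\alpha\}$. *)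

theory Defs
  imports "HOL-Analysis.Analysis"
begin

section \<open>The torus and its complex neighbourhoods\<close>

text \<open>
  Functions on the real torus, or on its complex neighbourhood of width \<open>\<sigma>\<close>, are represented by
  functions on \<open>real ^ 'n\<close>, respectively on \<open>strip \<sigma>\<close>, that are \<open>2\<pi>\<close>-periodic in
  every coordinate direction.  The size of the imaginary part is measured in the Euclidean norm.
\<close>

definition strip :: "real \<Rightarrow> (complex ^ 'n) set" where
  "strip \<sigma> = {\<theta>. norm (\<chi> i. Im (\<theta> $ i)) < \<sigma>}"

definition complexify :: "real ^ 'n \<Rightarrow> complex ^ 'n" where
  "complexify \<theta> = (\<chi> i. complex_of_real (\<theta> $ i))"

definition torus_periodic :: "('a::real_algebra_1 ^ 'n) set \<Rightarrow> ('a ^ 'n \<Rightarrow> 'b) \<Rightarrow> bool" where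
  "torus_periodic S f \<longleftrightarrow>
     (\<forall>\<theta>\<in>S. \<forall>k :: int ^ 'n. f (\<theta> + (\<chi> i. of_real (2 * pi * of_int (k $ i)))) = f \<theta>)"

definition C1_function :: "('a::real_normed_vector \<Rightarrow> 'b::real_normed_vector) \<Rightarrow> bool" where
  "C1_function f \<longleftrightarrow>
     (\<exists>D. (\<forall>p. (f has_derivative blinfun_apply (D p)) (at p)) \<and> continuous_on UNIV D)"

text \<open>
  Analyticity in several complex variables is complex Frechet differentiability at every point of
  an open set, i.e. real differentiability with a complex-linear derivative.
\<close>

definition holomorphic_Cn :: "(complex ^ 'n \<Rightarrow> complex) \<Rightarrow> (complex ^ 'n) set \<Rightarrow> bool" where
  "holomorphic_Cn f S \<longleftrightarrow>
     (\<forall>\<theta>\<in>S. \<exists>f'. (f has_derivative f') (at \<theta>) \<and> (\<forall>c v. f' (c *s v) = c * f' v))"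

definition analytic_extension ::
    "real \<Rightarrow> (real ^ 'n \<Rightarrow> real) \<Rightarrow> (complex ^ 'n \<Rightarrow> complex) \<Rightarrow> bool" where
  "analytic_extension \<sigma> f F \<longleftrightarrow>
     torus_periodic UNIV f \<and> torus_periodic (strip \<sigma>) F \<and> holomorphic_Cn F (strip \<sigma>) \<and>
     (\<forall>\<theta>. F (complexify \<theta>) = complex_of_real (f \<theta>))"

section \<open>Infinite matrices\<close>

text \<open>
  Sequences and matrices are indexed by the positive integers; values at index 0 are never used.
  The entry in row \<open>i\<close> and column \<open>j\<close> is \<open>A i j\<close>.
\<close>

type_synonym inf_matrix = "nat \<Rightarrow> nat \<Rightarrow> complex"

definition ell2 :: "(nat \<Rightarrow> complex) set" where
  "ell2 = {u. (\<lambda>j. (cmod (u j))\<^sup>2) summable_on {1..}}"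

definition ell2_norm :: "(nat \<Rightarrow> complex) \<Rightarrow> real" where
  "ell2_norm u = sqrt (\<Sum>\<^sub>\<infinity>j\<in>{1..}. (cmod (u j))\<^sup>2)"

definition mat_apply :: "inf_matrix \<Rightarrow> (nat \<Rightarrow> complex) \<Rightarrow> nat \<Rightarrow> complex" where
  "mat_apply A u i = (\<Sum>\<^sub>\<infinity>j\<in>{1..}. A i j * u j)"

definition bounded_mats :: "inf_matrix set" where
  "bounded_mats = {A.
     (\<forall>u\<in>ell2. (\<forall>i\<ge>1. (\<lambda>j. A i j * u j) summable_on {1..}) \<and> mat_apply A u \<in> ell2) \<and>
     (\<exists>C. \<forall>u\<in>ell2. ell2_norm (mat_apply A u) \<le> C * ell2_norm u)}"

definition op_norm :: "inf_matrix \<Rightarrow> real" where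
  "op_norm A = Sup {ell2_norm (mat_apply A u) | u. u \<in> ell2 \<and> ell2_norm u \<le> 1}"

definition diff_mat :: "inf_matrix \<Rightarrow> inf_matrix" where
  "diff_mat A = (\<lambda>i j. A (i + 1) (j + 1) - A i j)"

definition weighted_entries :: "real \<Rightarrow> inf_matrix \<Rightarrow> real set" where
  "weighted_entries \<alpha> A = {real (min i j) powr \<alpha> * cmod (A i j) | i j. i \<ge> 1 \<and> j \<ge> 1}"

definition weighted_mats :: "real \<Rightarrow> inf_matrix set" where
  "weighted_mats \<alpha> = {A. bdd_above (weighted_entries \<alpha> A)}"

definition weighted_norm :: "real \<Rightarrow> inf_matrix \<Rightarrow> real" where
  "weighted_norm \<alpha> A = Sup (weighted_entries \<alpha> A)"

definition hat_mats :: "real \<Rightarrow> inf_matrix set" where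
  "hat_mats \<alpha> = {A \<in> bounded_mats. diff_mat A \<in> weighted_mats \<alpha>}"

definition hat_norm :: "real \<Rightarrow> inf_matrix \<Rightarrow> real" where
  "hat_norm \<alpha> A = max (op_norm A) (weighted_norm \<alpha> (diff_mat A))"

section \<open>Analytic matrix-valued maps\<close>

text \<open>
  \<open>analytic_into X N F S\<close>: the map \<open>F\<close> sends the open set \<open>S\<close> into the space \<open>X\<close> of matrices and is
  complex Frechet differentiable there with respect to the norm \<open>N\<close>.  The derivative \<open>L\<close> has
  a finite-dimensional domain, so its boundedness is automatic.
\<close>

definition analytic_into ::
    "inf_matrix set \<Rightarrow> (inf_matrix \<Rightarrow> real) \<Rightarrow> (complex ^ 'n \<Rightarrow> inf_matrix) \<Rightarrow> (complex ^ 'n) set \<Rightarrow> bool"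
  where
  "analytic_into X N F S \<longleftrightarrow>
     (\<forall>\<theta>\<in>S. F \<theta> \<in> X) \<and>
     (\<forall>\<theta>\<in>S. \<exists>L :: complex ^ 'n \<Rightarrow> inf_matrix.
        (\<forall>v. L v \<in> X) \<and>
        (\<forall>v w. L (v + w) = (\<lambda>i j. L v i j + L w i j)) \<and>
        (\<forall>c v. L (c *s v) = (\<lambda>i j. c * L v i j)) \<and>
        ((\<lambda>v. N (\<lambda>i j. F (\<theta> + v) i j - F \<theta> i j - L v i j) / norm v) \<longlongrightarrow> 0) (at 0))"

text \<open>
  The real matrix-valued map \<open>F\<close> on the real torus is real analytic, with analytic extension \<open>G\<close> to
  the complex neighbourhood of width \<open>\<sigma>\<close>.
\<close>

definition real_analytic_into ::
    "real \<Rightarrow> inf_matrix set \<Rightarrow> (inf_matrix \<Rightarrow> real) \<Rightarrow>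
     (real ^ 'n \<Rightarrow> nat \<Rightarrow> nat \<Rightarrow> real) \<Rightarrow> (complex ^ 'n \<Rightarrow> inf_matrix) \<Rightarrow> bool" where
  "real_analytic_into \<sigma> X N F G \<longleftrightarrow>
     torus_periodic UNIV F \<and> torus_periodic (strip \<sigma>) G \<and> analytic_into X N G (strip \<sigma>) \<and>
     (\<forall>\<theta>. \<forall>i\<ge>1. \<forall>j\<ge>1. G (complexify \<theta>) i j = complex_of_real (F \<theta> i j))"

section \<open>The Hermite basis\<close>

text \<open>
  The normalized eigenfunctions are determined up to a sign only, and the difference matrix of
  the matrix of a multiplication operator depends on the choice of these signs.  As usual for Hermite
  functions, each one is taken to be positive near \<open>+\<infinity>\<close>, which amounts to a positive leading
  coefficient of the Hermite polynomial.
\<close>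

definition hermite_basis :: "(nat \<Rightarrow> real \<Rightarrow> real) \<Rightarrow> bool" where
  "hermite_basis h \<longleftrightarrow> (\<forall>i\<ge>1.
     h i differentiable_on UNIV \<and> deriv (h i) differentiable_on UNIV \<and>
     (\<forall>x. - deriv (deriv (h i)) x + x\<^sup>2 * h i x = (2 * real i - 1) * h i x) \<and>
     integrable lborel (\<lambda>x. (h i x)\<^sup>2) \<and> (LINT x|lborel. (h i x)\<^sup>2) = 1 \<and>
     (\<forall>\<^sub>F x in at_top. h i x > 0))"

text \<open>Used both for real and for complex values of \<open>\<theta>\<close> and of \<open>V\<close>.\<close>

definition potential_matrix ::
    "(nat \<Rightarrow> real \<Rightarrow> real) \<Rightarrow> (real \<Rightarrow> 'a \<Rightarrow> 'b::{banach, second_countable_topology}) \<Rightarrow>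
     'a \<Rightarrow> nat \<Rightarrow> nat \<Rightarrow> 'b" where
  "potential_matrix h V \<theta> i j = (LINT x|lborel. (h i x * h j x) *\<^sub>R V x \<theta>)"

end

theory Submission
  imports
    Defs
    "HOL-Probability.Distributions"
    "HOL-Complex_Analysis.Cauchy_Integral_Formula"
    "HOL-Real_Asymp.Real_Asymp"
begin

text \<open>
  A positive \<open>L\<^sup>2\<close> solution of \<open>h'' = (x\<^sup>2 - \<lambda>) h\<close> near \<open>+\<infinity>\<close> is convex, hence decreasing with bounded
  derivative, so its Wronskian with the polynomial-times-Gaussian solution tends to \<open>0\<close> at \<open>+\<infinity>\<close> and
  therefore vanishes.  This identifies \<open>h\<^sub>i\<close> with the normalized Hermite function and yields the
  ladder relations, orthonormality, and \<open>\<integral> x\<^sup>2 h\<^sub>i\<^sup>2 \<le> 2 i - 1\<close>.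

  The ladder relations give
  \<open>(h\<^sub>i h\<^bsub>j+1\<^esub> + h\<^bsub>i+1\<^esub> h\<^sub>j)' = \<surd>2 (\<surd>i + \<surd>j) (h\<^sub>i h\<^sub>j - h\<^bsub>i+1\<^esub> h\<^bsub>j+1\<^esub>)\<close>.  Integrating \<open>V\<close> against it by
  parts and using \<open>\<integral> (1 + |x|)\<^sup>\<delta> |h\<^sub>a h\<^sub>b| \<le> 4 a\<^bsup>\<delta>/2\<^esup>\<close>, the entries of \<open>\<Delta> P\<close> are at most
  \<open>8 C\<^sub>0 min(i,j)\<^bsup>-(1-\<delta>)/2\<^esup>\<close> uniformly on the strip.  Analyticity follows from Cauchy estimates, applied
  to \<open>V(x, \<cdot>)\<close> for the operator norm and to each scalar function \<open>(\<Delta> P)\<^sub>i\<^sup>j\<close> for the weighted norm.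
\<close>

section \<open>Integration by parts against Gaussians\<close>

text \<open>Integration by parts on \<open>[-n, n]\<close> moves the derivative from
  \<open>g\<close> to \<open>V\<close>; the boundary terms are at most \<open>B\<close> times the
  values of \<open>g\<close> at the two ends and vanish as \<open>n\<close> grows. The majorant
  \<open>m\<close> stands in for \<open>V' * g\<close>, so that continuity of \<open>V'\<close> is
  never invoked.\<close>

lemma norm_integral_deriv_mult_le:
  fixes V V' :: "real \<Rightarrow> complex" and g g' m :: "real \<Rightarrow> real"
  assumes V: "\<And>x. (V has_vector_derivative V' x) (at x)"
    and B: "\<And>x. cmod (V x) \<le> B"
    and g: "\<And>x. (g has_real_derivative g' x) (at x)"
    and cont: "continuous_on UNIV g'" "continuous_on UNIV m"
    and int: "integrable lborel g'" "integrable lborel m"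
    and lim: "(g \<longlongrightarrow> 0) at_top" "(g \<longlongrightarrow> 0) at_bot"
    and m: "\<And>x. cmod (V' x) * \<bar>g x\<bar> \<le> m x"
  shows "cmod (LINT x|lborel. g' x *\<^sub>R V x) \<le> (LINT x|lborel. m x)"
proof -
  have contV: "continuous_on S V" for S
    using V by (meson continuous_at_imp_continuous_on has_vector_derivative_continuous)
  have contG: "continuous_on S (\<lambda>x. g' x *\<^sub>R V x)" for S
    by (intro continuous_intros contV continuous_on_subset[OF cont(1)]) auto
  have [measurable]: "V \<in> borel_measurable borel" "g' \<in> borel_measurable borel"
    using contV cont(1) by (auto intro: borel_measurable_continuous_onI)
  have intG: "integrable lborel (\<lambda>x. g' x *\<^sub>R V x)"
  proof (rule Bochner_Integration.integrable_bound)
    show "integrable lborel (\<lambda>x. B * g' x)" using int by simp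
    have "B \<ge> 0" using B[of 0] norm_ge_zero order_trans by blast
    then show "AE x in lborel. norm (g' x *\<^sub>R V x) \<le> norm (B * g' x)"
      using B by (auto simp: abs_mult mult.commute[of _ "cmod _"] intro!: mult_right_mono)
  qed measurable
  have m0: "m x \<ge> 0" for x
    using m[of x] by (meson abs_ge_zero mult_nonneg_nonneg norm_ge_zero order_trans)
  define J where "J n = integral {-real n..real n} (\<lambda>x. g' x *\<^sub>R V x)" for n :: nat
  have J_eq: "J n = (LINT x|lborel. indicator {-real n..real n} x *\<^sub>R (g' x *\<^sub>R V x))" for n
  proof -
    have "set_integrable lborel {-real n..real n} (\<lambda>x. g' x *\<^sub>R V x)"
      unfolding set_integrable_def by (rule integrable_mult_indicator[OF _ intG]) simp
    from set_borel_integral_eq_integral(2)[OF this] show ?thesis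
      by (simp add: J_def set_lebesgue_integral_def)
  qed
  have "J \<longlonglongrightarrow> (LINT x|lborel. g' x *\<^sub>R V x)"
    unfolding J_eq[abs_def]
  proof (rule integral_dominated_convergence[where w="\<lambda>x. norm (g' x *\<^sub>R V x)"])
    show "AE x in lborel. (\<lambda>n. indicator {-real n..real n} x *\<^sub>R (g' x *\<^sub>R V x)) \<longlonglongrightarrow> g' x *\<^sub>R V x"
    proof (intro AE_I2 tendsto_eventually)
      fix x :: real
      obtain N where N: "\<bar>x\<bar> \<le> real N" using real_arch_simple by blast
      show "\<forall>\<^sub>F n in sequentially. indicator {-real n..real n} x *\<^sub>R (g' x *\<^sub>R V x) = g' x *\<^sub>R V x"
        using eventually_ge_at_top[of N] by eventually_elim (use N in \<open>auto simp: indicator_def\<close>)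
    qed
    show "integrable lborel (\<lambda>x. norm (g' x *\<^sub>R V x))" using intG by (rule integrable_norm)
  qed (auto simp: indicator_def)
  then have lim1: "(\<lambda>n. cmod (J n)) \<longlonglongrightarrow> cmod (LINT x|lborel. g' x *\<^sub>R V x)"
    by (rule tendsto_norm)
  have bound: "cmod (J n) \<le> B * (\<bar>g (real n)\<bar> + \<bar>g (- real n)\<bar>) + (LINT x|lborel. m x)" for n
  proof -
    let ?I = "{-real n..real n}"
    \<comment> \<open>The fundamental theorem for the gauge integral turns differentiability alone
      into integrability of the sum; subtracting the continuous term \<open>g' V\<close> isolates
      \<open>g V'\<close>.\<close>
    have FTC: "((\<lambda>x. g x *\<^sub>R V' x + g' x *\<^sub>R V x) has_integral
        g (real n) *\<^sub>R V (real n) - g (- real n) *\<^sub>R V (- real n)) ?I"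
      by (rule fundamental_theorem_of_calculus)
         (simp, rule has_vector_derivative_at_within[OF has_vector_derivative_scaleR[OF g V]])
    have GV: "(\<lambda>x. g' x *\<^sub>R V x) integrable_on ?I"
      by (rule integrable_continuous_real) (rule contG)
    have eq: "((\<lambda>x. g x *\<^sub>R V' x) has_integral
        (g (real n) *\<^sub>R V (real n) - g (- real n) *\<^sub>R V (- real n) - J n)) ?I"
      using has_integral_diff[OF FTC integrable_integral[OF GV]] by (simp add: J_def)
    have "m integrable_on ?I"
      by (rule integrable_continuous_real) (rule continuous_on_subset[OF cont(2)], simp)
    then have "cmod (integral ?I (\<lambda>x. g x *\<^sub>R V' x)) \<le> integral ?I m"
      using eq m by (intro integral_norm_bound_integral) (auto simp: mult.commute integrable_on_def)
    also have "integral ?I m = (LINT x:?I|lborel. m x)"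
      by (rule set_borel_integral_eq_integral(2)[symmetric], unfold set_integrable_def,
          rule integrable_mult_indicator[OF _ int(2)]) simp
    also have "\<dots> \<le> (LINT x|lborel. m x)"
      unfolding set_lebesgue_integral_def
      by (rule integral_mono[OF integrable_mult_indicator[OF _ int(2)] int(2)])
         (auto simp: indicator_def m0)
    finally have "cmod (g (real n) *\<^sub>R V (real n) - g (- real n) *\<^sub>R V (- real n) - J n)
        \<le> (LINT x|lborel. m x)"
      using eq by (simp add: integral_unique)
    moreover have "cmod j \<le> cmod a + cmod b + cmod (a - b - j)" for a b j :: complex
      using norm_triangle_ineq4[of "a - b" "a - b - j"] norm_triangle_ineq4[of a b] by simp
    note this[of "J n" "g (real n) *\<^sub>R V (real n)" "g (- real n) *\<^sub>R V (- real n)"]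
    moreover have "cmod (g y *\<^sub>R V y) \<le> B * \<bar>g y\<bar>" for y
      using mult_right_mono[OF B[of y], of "\<bar>g y\<bar>"] by (simp add: mult.commute)
    note this[of "real n"] this[of "- real n"]
    ultimately show ?thesis unfolding distrib_left by linarith
  qed
  have "(\<lambda>n. B * (\<bar>g (real n)\<bar> + \<bar>g (- real n)\<bar>) + (LINT x|lborel. m x)) \<longlonglongrightarrow>
      B * (\<bar>0\<bar> + \<bar>0\<bar>) + (LINT x|lborel. m x)"
    by (intro tendsto_intros filterlim_compose[OF lim(1)] filterlim_compose[OF lim(2)]
        filterlim_real_sequentially filterlim_compose[OF filterlim_uminus_at_bot_at_top])
  then show ?thesis
    using lim1 bound by (intro LIMSEQ_le[OF lim1]) auto
qed

section \<open>Polynomials times Gaussians\<close>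

definition gauss :: "real poly \<Rightarrow> real \<Rightarrow> real" where
  "gauss p x = poly p x * exp (- x\<^sup>2)"

text \<open>Half the exponent of \<open>gauss\<close>: single Hermite functions have this form, and
  products of two of them have the form \<open>gauss\<close>. Both families are closed under
  differentiation, which acts on the polynomial alone.\<close>

definition half_gauss :: "real poly \<Rightarrow> real \<Rightarrow> real" where
  "half_gauss p x = poly p x * exp (- x\<^sup>2 / 2)"

lemma half_gauss_mult: "half_gauss p x * half_gauss q x = gauss (p * q) x"
proof -
  have "exp (- x\<^sup>2 / 2) * exp (- x\<^sup>2 / 2) = exp (- x\<^sup>2)"
    by (simp flip: exp_add)
  then show ?thesis by (simp add: half_gauss_def gauss_def algebra_simps)
qed

lemma half_gauss_smult: "half_gauss (smult c p) x = c * half_gauss p x"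
  by (simp add: half_gauss_def)

lemma DERIV_gauss: "(gauss p has_real_derivative gauss (pderiv p - [:0, 2:] * p) x) (at x)"
  unfolding gauss_def[abs_def]
  by (auto intro!: derivative_eq_intros poly_DERIV simp: algebra_simps)

lemma DERIV_half_gauss: "(half_gauss p has_real_derivative half_gauss (pderiv p - [:0, 1:] * p) x) (at x)"
  unfolding half_gauss_def[abs_def]
  by (auto intro!: derivative_eq_intros poly_DERIV simp: algebra_simps)

lemma integrable_gauss: "integrable lborel (gauss p)"
proof -
  have "integrable lborel (\<lambda>x. coeff p k * x ^ k * exp (- x\<^sup>2))" for k
  proof -
    \<comment> \<open>The normal density with standard deviation \<open>1 / sqrt 2\<close> equals
      \<open>exp (- x\<^sup>2) / sqrt pi\<close>, so each monomial becomes a Gaussian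
      moment.\<close>
    have "integrable lborel (\<lambda>x. coeff p k * sqrt pi * (normal_density 0 (1 / sqrt 2) x * (x - 0) ^ k))"
      by (intro integrable_mult_right integrable_normal_moment) simp
    then show ?thesis
      by (simp add: normal_density_def power_divide real_sqrt_divide algebra_simps)
  qed
  then show ?thesis
    unfolding gauss_def[abs_def] poly_altdef sum_distrib_right by (intro Bochner_Integration.integrable_sum) auto
qed

lemma half_gauss_tendsto_0:
  "(half_gauss p \<longlongrightarrow> 0) at_top" "(half_gauss p \<longlongrightarrow> 0) at_bot"
proof -
  have "((\<lambda>x::real. x ^ k * exp (- x\<^sup>2 / 2)) \<longlongrightarrow> 0) at_top" for k
    by real_asymp
  then have *: "(half_gauss p \<longlongrightarrow> 0) at_top" for p
    unfolding half_gauss_def[abs_def] poly_altdef sum_distrib_right mult.assoc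
    by (intro tendsto_null_sum tendsto_mult_right_zero)
  show "(half_gauss p \<longlongrightarrow> 0) at_top" by (rule *)
  \<comment> \<open>Composing the polynomial with \<open>-x\<close> reflects the limit at minus
    infinity to plus infinity.\<close>
  have "((\<lambda>x. half_gauss (p \<circ>\<^sub>p [:0, -1:]) x) \<longlongrightarrow> 0) at_top" by (rule *)
  then have "((\<lambda>x. half_gauss p (- x)) \<longlongrightarrow> 0) at_top"
    by (simp add: half_gauss_def poly_pcompose)
  then show "(half_gauss p \<longlongrightarrow> 0) at_bot"
    by (simp add: filterlim_at_bot_mirror)
qed

lemma gauss_tendsto_0: "(gauss p \<longlongrightarrow> 0) at_top" "(gauss p \<longlongrightarrow> 0) at_bot"
proof -
  have "gauss p = (\<lambda>x. half_gauss p x * half_gauss 1 x)"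
    by (simp add: half_gauss_mult fun_eq_iff)
  then show "(gauss p \<longlongrightarrow> 0) at_top" "(gauss p \<longlongrightarrow> 0) at_bot"
    using tendsto_mult[OF half_gauss_tendsto_0(1) half_gauss_tendsto_0(1)]
      tendsto_mult[OF half_gauss_tendsto_0(2) half_gauss_tendsto_0(2)] by auto
qed

lemma continuous_gauss: "continuous_on S (gauss p)"
  unfolding gauss_def[abs_def] by (intro continuous_intros)

text \<open>The integrand is the derivative of \<open>gauss p\<close>, which vanishes at both ends;
  this is integration by parts against the constant 1, with majorant 0.\<close>

lemma LINT_gauss_deriv: "(LINT x|lborel. gauss (pderiv p - [:0, 2:] * p) x) = 0"
proof -
  have "cmod (LINT x|lborel. gauss (pderiv p - [:0, 2:] * p) x *\<^sub>R 1) \<le> (LINT (x::real)|lborel. 0)"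
    by (rule norm_integral_deriv_mult_le[where V'="\<lambda>_. 0" and B=1 and g="gauss p"])
       (intro DERIV_gauss continuous_gauss integrable_gauss gauss_tendsto_0 | simp)+
  then have "(LINT x|lborel. complex_of_real (gauss (pderiv p - [:0, 2:] * p) x)) = 0"
    by (simp add: scaleR_conv_of_real)
  then show ?thesis by simp
qed

section \<open>Hermite functions\<close>

text \<open>The physicists' Hermite polynomials, generated by the raising recursion.\<close>

fun herm :: "nat \<Rightarrow> real poly" where
  "herm 0 = 1"
| "herm (Suc n) = [:0, 2:] * herm n - pderiv (herm n)"

text \<open>The lowering relation. Once the recursion is differentiated, the induction hypothesis
  turns the derivative terms into a multiple of \<open>[:0, 2:] * herm n - pderiv (herm n)\<close>,
  which is \<open>herm (Suc n)\<close> again.\<close>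

lemma pderiv_herm: "pderiv (herm (Suc n)) = smult (2 * real (Suc n)) (herm n)"
proof (induction n)
  case 0
  show ?case by (simp add: pderiv_pCons)
next
  case (Suc n)
  have "pderiv (herm (Suc (Suc n))) = smult 2 (herm (Suc n)) + [:0, 2:] * pderiv (herm (Suc n))
      - pderiv (pderiv (herm (Suc n)))"
    by (subst herm.simps(2))
       (simp add: pderiv_diff pderiv_mult pderiv_pCons pderiv_smult algebra_simps del: herm.simps)
  also have "\<dots> = smult 2 (herm (Suc n)) + smult (2 * real (Suc n)) ([:0, 2:] * herm n - pderiv (herm n))"
    unfolding Suc.IH pderiv_smult by (simp add: smult_diff_right del: herm.simps)
  also have "[:0, 2:] * herm n - pderiv (herm n) = herm (Suc n)" by simp
  also have "smult 2 (herm (Suc n)) + smult (2 * real (Suc n)) (herm (Suc n))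
      = smult (2 * real (Suc (Suc n))) (herm (Suc n))"
    by (simp add: smult_add_left[symmetric] del: herm.simps)
  finally show ?case .
qed

lemma degree_herm: "degree (herm n) \<le> n"
proof (induction n)
  case (Suc n)
  have "degree ([:0, 2:] * herm n) \<le> 1 + degree (herm n)"
    by (rule order_trans[OF degree_mult_le]) simp
  moreover have "degree (pderiv (herm n)) \<le> degree (herm n)" by (simp add: degree_pderiv)
  ultimately show ?case using Suc by (auto intro!: degree_diff_le)
qed simp

lemma coeff_herm: "coeff (herm n) n = 2 ^ n"
proof (induction n)
  case (Suc n)
  have "coeff (pderiv (herm n)) (Suc n) = 0"
    using degree_herm[of n] by (simp add: coeff_pderiv coeff_eq_0)
  then show ?case using Suc by simp
qed simp

lemma lead_coeff_herm: "lead_coeff (herm n) = 2 ^ n"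
proof -
  have "degree (herm n) = n"
    using degree_herm[of n] coeff_herm[of n] by (metis le_antisym le_degree power_not_zero zero_neq_numeral)
  then show ?thesis by (simp add: coeff_herm)
qed

text \<open>The unnormalized Hermite functions, counted from 0: \<open>psi n\<close> is a multiple
  of \<open>h (Suc n)\<close>.\<close>

definition psi :: "nat \<Rightarrow> real \<Rightarrow> real" where
  "psi n = half_gauss (herm n)"

lemma DERIV_psi: "(psi n has_real_derivative x * psi n x - psi (Suc n) x) (at x)"
  unfolding psi_def
  by (rule DERIV_cong[OF DERIV_half_gauss]) (simp add: half_gauss_def algebra_simps)

lemma DERIV_psi_Suc:
  "(psi (Suc n) has_real_derivative 2 * real (Suc n) * psi n x - x * psi (Suc n) x) (at x)"
  unfolding psi_def
  by (rule DERIV_cong[OF DERIV_half_gauss], subst pderiv_herm)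
     (simp add: half_gauss_def algebra_simps)

text \<open>Raising followed by lowering returns to \<open>psi n\<close>. This is the eigenvalue
  equation; for \<open>i = n + 1\<close> the eigenvalue \<open>2 i - 1\<close> is
  \<open>2 n + 1\<close>.\<close>

lemma DERIV_psi_deriv:
  "((\<lambda>x. x * psi n x - psi (Suc n) x) has_real_derivative (x\<^sup>2 - (2 * real n + 1)) * psi n x) (at x)"
  by (rule derivative_eq_intros DERIV_psi DERIV_psi_Suc refl)+
     (simp add: algebra_simps power2_eq_square)

lemma psi_mult: "psi m x * psi n x = gauss (herm m * herm n) x"
  by (simp add: psi_def half_gauss_mult)

text \<open>Accepts any expression for the derivative, which spares computing its polynomial
  factor.\<close>

lemma LINT_eq_0_if_DERIV_gauss:
  assumes "\<And>x. F x = gauss p x" and "\<And>x. (F has_real_derivative f x) (at x)"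
  shows "(LINT x|lborel. f x) = 0"
proof -
  have "F = gauss p" using assms(1) by auto
  then have "f = gauss (pderiv p - [:0, 2:] * p)"
    using assms(2) DERIV_gauss DERIV_unique by blast
  then show ?thesis by (metis LINT_gauss_deriv)
qed

text \<open>In the derivative of \<open>psi m * psi (Suc n)\<close>, raising the first factor and
  lowering the second cancels the terms with \<open>x\<close>. The resulting recursion gives both
  orthogonality and the ratio of consecutive norms.\<close>

lemma psi_inner_Suc_Suc:
  "(LINT x|lborel. psi (Suc m) x * psi (Suc n) x) = 2 * real (Suc n) * (LINT x|lborel. psi m x * psi n x)"
proof -
  have int: "integrable lborel (\<lambda>x. psi m x * psi n x)" for m n
    using integrable_gauss by (simp add: psi_mult)
  have "(LINT x|lborel. 2 * real (Suc n) * (psi m x * psi n x) - psi (Suc m) x * psi (Suc n) x) = 0"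
  proof (rule LINT_eq_0_if_DERIV_gauss)
    show "psi m x * psi (Suc n) x = gauss (herm m * herm (Suc n)) x" for x
      by (rule psi_mult)
    show "((\<lambda>x. psi m x * psi (Suc n) x) has_real_derivative
        2 * real (Suc n) * (psi m x * psi n x) - psi (Suc m) x * psi (Suc n) x) (at x)" for x
      by (rule DERIV_cong[OF DERIV_mult[OF DERIV_psi DERIV_psi_Suc]]) (simp add: algebra_simps)
  qed
  then show ?thesis
    by (subst (asm) Bochner_Integration.integral_diff) (intro integrable_mult_right int, rule int, simp)
qed

lemma psi_inner_0_Suc: "(LINT x|lborel. psi 0 x * psi (Suc n) x) = 0"
proof -
  have "(LINT x|lborel. - (psi 0 x * psi (Suc n) x)) = 0"
  proof (rule LINT_eq_0_if_DERIV_gauss)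
    show "psi 0 x * psi n x = gauss (herm 0 * herm n) x" for x
      by (rule psi_mult)
    \<comment> \<open>This identity cancels everything in the derivative of
      \<open>psi 0 * psi n\<close> except \<open>- psi 0 * psi (Suc n)\<close>.\<close>
    have "psi (Suc 0) x = 2 * x * psi 0 x" for x
      by (simp add: psi_def half_gauss_def)
    then show "((\<lambda>x. psi 0 x * psi n x) has_real_derivative - (psi 0 x * psi (Suc n) x)) (at x)" for x
      by (intro DERIV_cong[OF DERIV_mult[OF DERIV_psi DERIV_psi]]) (simp add: algebra_simps)
  qed
  then show ?thesis by simp
qed

text \<open>The recursion lowers both indices together until exactly one of them is 0.\<close>

lemma psi_orthogonal: "m \<noteq> n \<Longrightarrow> (LINT x|lborel. psi m x * psi n x) = 0"
proof (induction m arbitrary: n)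
  case 0
  then show ?case by (cases n) (auto simp: psi_inner_0_Suc)
next
  case (Suc m)
  show ?case
  proof (cases n)
    case 0
    then show ?thesis using psi_inner_0_Suc[of m] by (simp add: mult.commute)
  next
    case (Suc k)
    then show ?thesis using Suc.IH[of k] Suc.prems psi_inner_Suc_Suc[of m k] by simp
  qed
qed

lemma psi_eventually_pos: "\<forall>\<^sub>F x in at_top. psi n x > 0"
proof -
  have pos: "lead_coeff (herm n) > 0" by (simp add: lead_coeff_herm)
  from poly_pinfty_gt_lc[OF this] obtain N where N: "\<forall>x\<ge>N. lead_coeff (herm n) \<le> poly (herm n) x"
    by blast
  show ?thesis
    using eventually_ge_at_top[of N]
    by eventually_elim (use N pos in \<open>force simp: psi_def half_gauss_def intro!: mult_pos_pos\<close>)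
qed

lemma psi_tendsto_0: "(psi n \<longlongrightarrow> 0) at_top"
  "((\<lambda>x. x * psi n x - psi (Suc n) x) \<longlongrightarrow> 0) at_top"
proof -
  have "(\<lambda>x. x * psi n x - psi (Suc n) x) = half_gauss ([:0, 1:] * herm n - herm (Suc n))"
    by (auto simp: psi_def half_gauss_def algebra_simps)
  then show "((\<lambda>x. x * psi n x - psi (Suc n) x) \<longlongrightarrow> 0) at_top" "(psi n \<longlongrightarrow> 0) at_top"
    by (simp_all only: psi_def half_gauss_tendsto_0)
qed

section \<open>Second-order linear equations on the line\<close>

text \<open>Beyond \<open>R\<close> the function is convex. A positive slope at \<open>a\<close>
  would persist and keep \<open>u\<close> above \<open>u a > 0\<close> on the whole half-line,
  against square integrability.\<close>

lemma deriv_nonpos_of_convex_L2: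
  fixes u u' q :: "real \<Rightarrow> real"
  assumes u: "\<And>x. (u has_real_derivative u' x) (at x)"
    and u': "\<And>x. (u' has_real_derivative q x * u x) (at x)"
    and pos: "\<And>x. x \<ge> R \<Longrightarrow> u x > 0" and q: "\<And>x. x \<ge> R \<Longrightarrow> q x \<ge> 0"
    and int: "integrable lborel (\<lambda>x. (u x)\<^sup>2)"
    and a: "a \<ge> R"
  shows "u' a \<le> 0"
proof (rule ccontr)
  assume "\<not> u' a \<le> 0"
  then have "u' a > 0" by simp
  have "u' x \<ge> u' a" if "x \<ge> a" for x
    by (rule DERIV_nonneg_imp_nondecreasing[OF that])
       (use u' pos q a in \<open>meson less_imp_le mult_nonneg_nonneg order_trans\<close>)
  then have u'_pos: "u' x \<ge> 0" if "x \<ge> a" for x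
    using that \<open>u' a > 0\<close> by force
  have u_ge: "u x \<ge> u a" if "x \<ge> a" for x
    by (rule DERIV_nonneg_imp_nondecreasing[OF that]) (use u u'_pos in blast)
  have "u a > 0" using pos a by simp
  obtain N where N: "(LINT x|lborel. (u x)\<^sup>2) < real N * (u a)\<^sup>2"
    using reals_Archimedean3[of "(u a)\<^sup>2"] \<open>u a > 0\<close> by auto
  have "real N * (u a)\<^sup>2 = (LINT x|lborel. indicator {a..a + real N} x * (u a)\<^sup>2)"
    by simp
  also have "\<dots> \<le> (LINT x|lborel. (u x)\<^sup>2)"
  proof (rule integral_mono)
    show "integrable lborel (\<lambda>x. indicator {a..a + real N} x * (u a)\<^sup>2)"
      by (intro integrable_mult_left) (simp add: integrable_indicator_iff)
    show "indicator {a..a + real N} x * (u a)\<^sup>2 \<le> (u x)\<^sup>2" for x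
      using u_ge[of x] \<open>u a > 0\<close> by (auto simp: indicator_def intro: power_mono)
  qed (rule int)
  finally show False using N by simp
qed

text \<open>Both functions solve the same equation, so the Wronskian is constant; each of its terms
  is a bounded factor times one that tends to 0.\<close>

lemma wronskian_eq_0:
  fixes u u' v v' q :: "real \<Rightarrow> real"
  assumes u: "\<And>x. (u has_real_derivative u' x) (at x)"
    and u': "\<And>x. (u' has_real_derivative q x * u x) (at x)"
    and v: "\<And>x. (v has_real_derivative v' x) (at x)"
    and v': "\<And>x. (v' has_real_derivative q x * v x) (at x)"
    and K: "\<And>x. x \<ge> R \<Longrightarrow> \<bar>u x\<bar> \<le> K" "\<And>x. x \<ge> R \<Longrightarrow> \<bar>u' x\<bar> \<le> K"
    and lim: "(v \<longlongrightarrow> 0) at_top" "(v' \<longlongrightarrow> 0) at_top"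
  shows "u x * v' x = u' x * v x"
proof -
  define W where "W x = u x * v' x - u' x * v x" for x
  have "(W has_real_derivative 0) (at x)" for x
    unfolding W_def[abs_def]
    by (rule derivative_eq_intros u u' v v' refl)+ (simp add: algebra_simps)
  then have const: "W y = W x" for y x
    using DERIV_isconst_all by blast
  have null: "((\<lambda>x. w x * z x) \<longlongrightarrow> 0) at_top"
    if w: "\<And>x. x \<ge> R \<Longrightarrow> \<bar>w x\<bar> \<le> K" and z: "(z \<longlongrightarrow> 0) at_top" for w z :: "real \<Rightarrow> real"
  proof (rule Lim_null_comparison)
    show "\<forall>\<^sub>F x in at_top. norm (w x * z x) \<le> K * \<bar>z x\<bar>"
      using eventually_ge_at_top[of R]
      by eventually_elim (use w in \<open>auto simp: abs_mult intro: mult_right_mono\<close>)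
    show "((\<lambda>x. K * \<bar>z x\<bar>) \<longlongrightarrow> 0) at_top"
      by (intro tendsto_mult_right_zero tendsto_rabs_zero z)
  qed
  have "((\<lambda>x. u x * v' x - u' x * v x) \<longlongrightarrow> 0 - 0) at_top"
    by (intro tendsto_diff null K lim)
  then have "(W \<longlongrightarrow> 0) at_top"
    by (simp add: W_def[abs_def])
  moreover have "(W \<longlongrightarrow> 0) at_top \<longleftrightarrow> ((\<lambda>_::real. W x) \<longlongrightarrow> 0) at_top"
    by (intro tendsto_cong always_eventually allI const)
  ultimately have "((\<lambda>_::real. W x) \<longlongrightarrow> 0) at_top" by simp
  then have "W x = 0" by (simp add: tendsto_const_iff)
  then show ?thesis by (simp add: W_def)
qed

text \<open>A Gronwall argument for the energy \<open>E = w\<^sup>2 + d\<^sup>2\<close>, whose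
  derivative is at most \<open>K * E\<close> in modulus when \<open>K\<close> bounds
  \<open>1 + q\<close> between \<open>a\<close> and \<open>b\<close>.\<close>

lemma second_order_ode_unique:
  fixes w d q :: "real \<Rightarrow> real"
  assumes w: "\<And>x. (w has_real_derivative d x) (at x)"
    and d: "\<And>x. (d has_real_derivative q x * w x) (at x)"
    and q: "continuous_on UNIV q"
    and init: "w a = 0" "d a = 0"
  shows "w b = 0"
proof -
  define E where "E x = (w x)\<^sup>2 + (d x)\<^sup>2" for x
  have E: "(E has_real_derivative 2 * (1 + q x) * (w x * d x)) (at x)" for x
    unfolding E_def[abs_def]
    by (rule derivative_eq_intros w d refl)+ (simp add: algebra_simps)
  have "compact ((\<lambda>x. 1 + q x) ` {min a b..max a b})"
    by (intro compact_continuous_image continuous_intros continuous_on_subset[OF q]) auto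
  then obtain K where K: "\<And>x. x \<in> {min a b..max a b} \<Longrightarrow> \<bar>1 + q x\<bar> \<le> K"
    using bounded_iff[of "(\<lambda>x. 1 + q x) ` {min a b..max a b}"] compact_imp_bounded by fastforce
  have E': "\<bar>2 * (1 + q x) * (w x * d x)\<bar> \<le> K * E x" if "x \<in> {min a b..max a b}" for x
  proof -
    have "2 * \<bar>w x * d x\<bar> \<le> E x"
      using sum_squares_bound[of "\<bar>w x\<bar>" "\<bar>d x\<bar>"] by (simp add: E_def abs_mult)
    then have "\<bar>1 + q x\<bar> * (2 * \<bar>w x * d x\<bar>) \<le> K * E x"
      using K[OF that] by (intro mult_mono) auto
    then show ?thesis by (simp only: abs_mult abs_numeral mult_ac)
  qed
  have "E a = 0" using init by (simp add: E_def)
  \<comment> \<open>To the right of \<open>a\<close> the factor \<open>exp (- K * x)\<close> makes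
    the energy nonincreasing; to the left, \<open>exp (K * x)\<close> makes it
    nondecreasing.\<close>
  have "E b \<le> 0"
  proof (cases "a \<le> b")
    case True
    have "E b * exp (- K * b) \<le> E a * exp (- K * a)"
    proof (rule DERIV_nonpos_imp_nonincreasing[OF True])
      fix x assume x: "a \<le> x" "x \<le> b"
      have "((\<lambda>x. E x * exp (- K * x)) has_real_derivative
          (2 * (1 + q x) * (w x * d x) - K * E x) * exp (- K * x)) (at x)"
        by (rule derivative_eq_intros E refl)+ (simp add: algebra_simps)
      moreover have "(2 * (1 + q x) * (w x * d x) - K * E x) * exp (- K * x) \<le> 0"
        using E'[of x] x by (intro mult_nonpos_nonneg) auto
      ultimately show "\<exists>y. ((\<lambda>x. E x * exp (- K * x)) has_real_derivative y) (at x) \<and> y \<le> 0"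
        by blast
    qed
    then show ?thesis using \<open>E a = 0\<close> by (simp add: mult_le_0_iff)
  next
    case False
    then have "b \<le> a" by simp
    have "E b * exp (K * b) \<le> E a * exp (K * a)"
    proof (rule DERIV_nonneg_imp_nondecreasing[OF \<open>b \<le> a\<close>])
      fix x assume x: "b \<le> x" "x \<le> a"
      have "((\<lambda>x. E x * exp (K * x)) has_real_derivative
          (2 * (1 + q x) * (w x * d x) + K * E x) * exp (K * x)) (at x)"
        by (rule derivative_eq_intros E refl)+ (simp add: algebra_simps)
      moreover have "(2 * (1 + q x) * (w x * d x) + K * E x) * exp (K * x) \<ge> 0"
        using E'[of x] x by (intro mult_nonneg_nonneg) auto
      ultimately show "\<exists>y. ((\<lambda>x. E x * exp (K * x)) has_real_derivative y) (at x) \<and> y \<ge> 0"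
        by blast
    qed
    then show ?thesis using \<open>E a = 0\<close> by (simp add: mult_le_0_iff)
  qed
  then have "(w b)\<^sup>2 \<le> 0"
    using zero_le_power2[of "d b"] unfolding E_def by linarith
  then show ?thesis by simp
qed

section \<open>Identification of the Hermite basis\<close>

text \<open>The vanishing Wronskian with \<open>psi n\<close> makes the Cauchy data of the two
  solutions proportional at \<open>R\<close>, and uniqueness for the equation spreads this to the
  line. The sign convention at plus infinity makes the factor positive.\<close>

lemma hermite_basis_eq_psi:
  assumes "hermite_basis h"
  shows "\<exists>c>0. \<forall>x. h (Suc n) x = c * psi n x"
proof -
  define u where "u = h (Suc n)"
  define q where "q x = x\<^sup>2 - (2 * real n + 1)" for x :: real
  have "u differentiable_on UNIV" "deriv u differentiable_on UNIV"
    and ode: "\<And>x. - deriv (deriv u) x + x\<^sup>2 * u x = (2 * real (Suc n) - 1) * u x"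
    and int: "integrable lborel (\<lambda>x. (u x)\<^sup>2)"
    and pos: "\<forall>\<^sub>F x in at_top. u x > 0"
    using assms unfolding hermite_basis_def u_def by auto
  then have u: "(u has_real_derivative deriv u x) (at x)"
    and "(deriv u has_real_derivative deriv (deriv u) x) (at x)" for x
    by (auto simp: DERIV_deriv_iff_real_differentiable differentiable_on_def)
  moreover have "deriv (deriv u) x = q x * u x" for x
    using ode[of x] by (simp add: q_def algebra_simps)
  ultimately have u': "(deriv u has_real_derivative q x * u x) (at x)" for x
    by simp
  have v': "((\<lambda>x. x * psi n x - psi (Suc n) x) has_real_derivative q x * psi n x) (at x)" for x
    using DERIV_psi_deriv by (simp add: q_def)
  have q_cont: "continuous_on UNIV q"
    unfolding q_def[abs_def] by (intro continuous_intros)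
  have "\<forall>\<^sub>F x in at_top. q x \<ge> 0"
    unfolding q_def by real_asymp
  with pos psi_eventually_pos[of n] have "\<forall>\<^sub>F x in at_top. u x > 0 \<and> q x \<ge> 0 \<and> psi n x > 0"
    by eventually_elim auto
  then obtain R where R: "\<And>x. x \<ge> R \<Longrightarrow> u x > 0" "\<And>x. x \<ge> R \<Longrightarrow> q x \<ge> 0" "psi n R > 0"
    by (auto simp: eventually_at_top_linorder)
  have nonpos: "deriv u x \<le> 0" if "x \<ge> R" for x
    by (rule deriv_nonpos_of_convex_L2[where u=u and q=q and R=R]) (use u u' R int that in auto)
  \<comment> \<open>Beyond \<open>R\<close> the slope is nondecreasing and nonpositive, hence
    bounded by its size at \<open>R\<close>; likewise \<open>u\<close> stays between 0 and
    \<open>u R\<close>.\<close>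
  have "deriv u R \<le> deriv u x" if "x \<ge> R" for x
    by (rule DERIV_nonneg_imp_nondecreasing[OF that])
       (use u' R in \<open>meson less_imp_le mult_nonneg_nonneg\<close>)
  then have K': "\<bar>deriv u x\<bar> \<le> \<bar>u R\<bar> + \<bar>deriv u R\<bar>" if "x \<ge> R" for x
    using nonpos[OF that] that by fastforce
  have "u x \<le> u R" if "x \<ge> R" for x
    by (rule DERIV_nonpos_imp_nonincreasing[OF that]) (use u nonpos in blast)
  then have K: "\<bar>u x\<bar> \<le> \<bar>u R\<bar> + \<bar>deriv u R\<bar>" if "x \<ge> R" for x
    using R(1)[OF that] that by fastforce
  have wronskian: "u x * (x * psi n x - psi (Suc n) x) = deriv u x * psi n x" for x
    by (rule wronskian_eq_0[where R=R and K="\<bar>u R\<bar> + \<bar>deriv u R\<bar>", OF u u' DERIV_psi v' _ _ psi_tendsto_0])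
       (use K K' in auto)
  \<comment> \<open>This choice makes \<open>u - c * psi n\<close> vanish at \<open>R\<close>; the
    Wronskian identity then makes its derivative vanish there as well.\<close>
  define c where "c = u R / psi n R"
  have "u x - c * psi n x = 0" for x
  proof (rule second_order_ode_unique[where q=q and a=R and b=x and w="\<lambda>x. u x - c * psi n x" and
        d="\<lambda>x. deriv u x - c * (x * psi n x - psi (Suc n) x)"])
    show "((\<lambda>x. u x - c * psi n x) has_real_derivative
        deriv u x - c * (x * psi n x - psi (Suc n) x)) (at x)" for x
      by (intro DERIV_diff DERIV_cmult u DERIV_psi)
    show "((\<lambda>x. deriv u x - c * (x * psi n x - psi (Suc n) x)) has_real_derivative
        q x * (u x - c * psi n x)) (at x)" for x
      by (rule DERIV_cong[OF DERIV_diff[OF u' DERIV_cmult[OF v']]]) (simp add: algebra_simps)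
    show "u R - c * psi n R = 0" using R(3) by (simp add: c_def)
    show "deriv u R - c * (R * psi n R - psi (Suc n) R) = 0"
      using R(3) wronskian[of R] by (simp add: c_def field_simps)
  qed (rule q_cont)
  moreover have "c > 0" using R by (simp add: c_def)
  ultimately show ?thesis by (auto simp: u_def)
qed

lemma hermite_basis_ladder:
  assumes h: "hermite_basis h" and i: "i \<ge> 1"
  shows "(h i has_real_derivative x * h i x - sqrt (2 * real i) * h (Suc i) x) (at x)"
    and "(h (Suc i) has_real_derivative sqrt (2 * real i) * h i x - x * h (Suc i) x) (at x)"
proof -
  obtain n where n: "i = Suc n" using i by (cases i) auto
  obtain c where c: "c > 0" "h i = (\<lambda>x. c * psi n x)"
    using hermite_basis_eq_psi[OF h, of n] n by blast
  obtain d where d: "d > 0" "h (Suc i) = (\<lambda>x. d * psi (Suc n) x)"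
    using hermite_basis_eq_psi[OF h, of "Suc n"] n by blast
  have norm: "(LINT x|lborel. (h i x)\<^sup>2) = 1" "(LINT x|lborel. (h (Suc i) x)\<^sup>2) = 1"
    using h i unfolding hermite_basis_def by auto
  have "c\<^sup>2 * (LINT x|lborel. psi n x * psi n x) = 1" "d\<^sup>2 * (LINT x|lborel. psi (Suc n) x * psi (Suc n) x) = 1"
    using norm by (simp_all add: c d power_mult_distrib power2_eq_square mult_ac)
  \<comment> \<open>Comparing the two normalizations through the norm ratio \<open>2 i\<close>
    determines the quotient of \<open>c\<close> and \<open>d\<close> up to sign; positivity of both
    settles the sign.\<close>
  then have "d\<^sup>2 * (2 * real i) * (LINT x|lborel. psi n x * psi n x) = c\<^sup>2 * (LINT x|lborel. psi n x * psi n x)"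
    and "(LINT x|lborel. psi n x * psi n x) \<noteq> 0"
    unfolding psi_inner_Suc_Suc n by (auto simp: mult_ac)
  then have "(d * sqrt (2 * real i))\<^sup>2 = c\<^sup>2" by (simp add: power_mult_distrib)
  then have cd: "c = d * sqrt (2 * real i)"
    using c(1) d(1) by (simp add: power2_eq_iff_nonneg)
  have sq: "sqrt (2 * real i) * sqrt (2 * real i) = 2 * real i" by simp
  show "(h i has_real_derivative x * h i x - sqrt (2 * real i) * h (Suc i) x) (at x)"
    unfolding c(2) d(2)
    by (rule DERIV_cong[OF DERIV_cmult[OF DERIV_psi]]) (simp add: cd algebra_simps)
  have "d * (2 * real (Suc n) * psi n x - x * psi (Suc n) x) =
      sqrt (2 * real i) * (c * psi n x) - x * (d * psi (Suc n) x)"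
    using sq by (simp add: cd n algebra_simps)
  then show "(h (Suc i) has_real_derivative sqrt (2 * real i) * h i x - x * h (Suc i) x) (at x)"
    unfolding c(2) d(2) by (intro DERIV_cong[OF DERIV_cmult[OF DERIV_psi_Suc]])
qed

section \<open>Regularity, orthonormality and moments of the basis\<close>

lemma hermite_basis_continuous:
  assumes "hermite_basis h" "i \<ge> 1" shows "continuous_on UNIV (h i)"
  using assms differentiable_imp_continuous_on unfolding hermite_basis_def by blast

lemma hermite_basis_measurable:
  assumes "hermite_basis h" "i \<ge> 1" shows "h i \<in> borel_measurable borel"
  using hermite_basis_continuous[OF assms] by (rule borel_measurable_continuous_onI)

lemma hermite_basis_half_gauss:
  assumes "hermite_basis h" "i \<ge> 1"
  shows "\<exists>p. h i = half_gauss p"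
proof -
  obtain n where n: "i = Suc n" using assms by (cases i) auto
  obtain c where "\<forall>x. h i x = c * psi n x"
    using hermite_basis_eq_psi[OF assms(1), of n] n by blast
  then have "h i = half_gauss (smult c (herm n))"
    by (auto simp: psi_def half_gauss_smult)
  then show ?thesis by blast
qed

lemma hermite_basis_mult_gauss:
  assumes "hermite_basis h" "i \<ge> 1" "j \<ge> 1"
  shows "\<exists>p. (\<lambda>x. h i x * h j x) = gauss p"
proof -
  obtain p q where "h i = half_gauss p" "h j = half_gauss q"
    using assms hermite_basis_half_gauss by metis
  then show ?thesis by (auto simp: half_gauss_mult fun_eq_iff)
qed

lemma hermite_basis_mult_integrable:
  assumes "hermite_basis h" "i \<ge> 1" "j \<ge> 1"
  shows "integrable lborel (\<lambda>x. h i x * h j x)"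
  using hermite_basis_mult_gauss[OF assms] integrable_gauss by metis

lemma hermite_basis_orthonormal:
  assumes h: "hermite_basis h" "i \<ge> 1" "j \<ge> 1"
  shows "(LINT x|lborel. h i x * h j x) = of_bool (i = j)"
proof (cases "i = j")
  case True
  then show ?thesis using h by (simp add: hermite_basis_def power2_eq_square)
next
  case False
  obtain m n where mn: "i = Suc m" "j = Suc n" using h by (cases i; cases j) auto
  obtain c d where "\<forall>x. h i x = c * psi m x" "\<forall>x. h j x = d * psi n x"
    using hermite_basis_eq_psi[OF h(1), of m] hermite_basis_eq_psi[OF h(1), of n] mn by blast
  then have "(LINT x|lborel. h i x * h j x) = (LINT x|lborel. (c * d) * (psi m x * psi n x))"
    by (simp add: mult_ac)
  also have "\<dots> = 0" using psi_orthogonal[of m n] False mn by simp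
  finally show ?thesis using False by simp
qed

text \<open>Integrating \<open>(h h')'\<close> and inserting the equation gives \<open>\<integral> h'\<^sup>2 + \<integral> x\<^sup>2 h\<^sup>2 = 2 i - 1\<close>.\<close>

lemma hermite_basis_second_moment:
  assumes h: "hermite_basis h" and i: "i \<ge> 1"
  shows "integrable lborel (\<lambda>x. x\<^sup>2 * (h i x)\<^sup>2)"
    and "(LINT x|lborel. x\<^sup>2 * (h i x)\<^sup>2) \<le> 2 * real i - 1"
proof -
  obtain p where p: "h i = half_gauss p" using hermite_basis_half_gauss[OF h i] by blast
  define r where "r = pderiv p - [:0, 1:] * p"
  define d where "d = half_gauss r"
  have d: "(h i has_real_derivative d x) (at x)" for x
    unfolding d_def r_def p by (rule DERIV_half_gauss)
  then have "d = (\<lambda>x. x * h i x - sqrt (2 * real i) * h (Suc i) x)"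
    using hermite_basis_ladder(1)[OF h i] DERIV_unique by blast
  have "((\<lambda>x. x * h i x - sqrt (2 * real i) * h (Suc i) x) has_real_derivative
      (x\<^sup>2 - (2 * real i - 1)) * h i x) (at x)" for x
    by (rule derivative_eq_intros hermite_basis_ladder h i refl)+
       (simp add: algebra_simps power2_eq_square flip: real_sqrt_mult)
  then have d': "(d has_real_derivative (x\<^sup>2 - (2 * real i - 1)) * h i x) (at x)" for x
    by (simp add: \<open>d = (\<lambda>x. x * h i x - sqrt (2 * real i) * h (Suc i) x)\<close>)
  have "(\<lambda>x. x\<^sup>2 * (h i x)\<^sup>2) = gauss ([:0, 0, 1:] * (p * p))"
    by (simp add: p half_gauss_mult gauss_def fun_eq_iff power2_eq_square)
  then show int: "integrable lborel (\<lambda>x. x\<^sup>2 * (h i x)\<^sup>2)"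
    using integrable_gauss by metis
  have int_d: "integrable lborel (\<lambda>x. (d x)\<^sup>2)"
    by (simp add: d_def power2_eq_square half_gauss_mult integrable_gauss[unfolded eta_contract_eq])
  have int_h: "integrable lborel (\<lambda>x. (h i x)\<^sup>2)" "(LINT x|lborel. (h i x)\<^sup>2) = 1"
    using h i unfolding hermite_basis_def by auto
  have "0 = (LINT x|lborel. (d x)\<^sup>2 + (x\<^sup>2 * (h i x)\<^sup>2 - (2 * real i - 1) * (h i x)\<^sup>2))"
  proof (rule LINT_eq_0_if_DERIV_gauss[symmetric])
    show "h i x * d x = gauss (p * r) x" for x
      by (simp add: p d_def half_gauss_mult)
    show "((\<lambda>x. h i x * d x) has_real_derivative
        (d x)\<^sup>2 + (x\<^sup>2 * (h i x)\<^sup>2 - (2 * real i - 1) * (h i x)\<^sup>2)) (at x)" for x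
      by (rule DERIV_cong[OF DERIV_mult[OF d d']]) (simp add: algebra_simps power2_eq_square)
  qed
  also have "\<dots> = (LINT x|lborel. (d x)\<^sup>2) + ((LINT x|lborel. x\<^sup>2 * (h i x)\<^sup>2) - (2 * real i - 1))"
    using int int_d int_h by simp
  finally have "0 = (LINT x|lborel. (d x)\<^sup>2) + ((LINT x|lborel. x\<^sup>2 * (h i x)\<^sup>2) - (2 * real i - 1))" .
  moreover have "(LINT x|lborel. (d x)\<^sup>2) \<ge> 0" by simp
  ultimately show "(LINT x|lborel. x\<^sup>2 * (h i x)\<^sup>2) \<le> 2 * real i - 1"
    by linarith
qed

text \<open>The integrand is dominated by \<open>B\<close> times an integrable product. The weight
  \<open>W\<close> will be the potential, its derivative in \<theta>, or the Taylor remainder of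
  that expansion.\<close>

lemma hermite_basis_mult_bounded:
  fixes W :: "real \<Rightarrow> complex"
  assumes h: "hermite_basis h" "i \<ge> 1" "j \<ge> 1"
    and W: "W \<in> borel_measurable borel" and B: "\<And>x. cmod (W x) \<le> B"
  shows "integrable lborel (\<lambda>x. (h i x * h j x) *\<^sub>R W x)"
    and "cmod (LINT x|lborel. (h i x * h j x) *\<^sub>R W x) \<le> B * (LINT x|lborel. \<bar>h i x * h j x\<bar>)"
proof -
  note [measurable] = hermite_basis_measurable[OF h(1,2)] hermite_basis_measurable[OF h(1,3)] W
  have int: "integrable lborel (\<lambda>x. B * \<bar>h i x * h j x\<bar>)"
    using hermite_basis_mult_integrable[OF h] by simp
  have le: "norm ((h i x * h j x) *\<^sub>R W x) \<le> B * \<bar>h i x * h j x\<bar>" for x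
    using mult_left_mono[OF B[of x], of "\<bar>h i x * h j x\<bar>"] by (simp add: mult.commute)
  show int': "integrable lborel (\<lambda>x. (h i x * h j x) *\<^sub>R W x)"
    by (rule Bochner_Integration.integrable_bound[OF int])
       (use le in \<open>auto intro!: AE_I2 intro: order_trans[OF _ abs_ge_self]\<close>)
  have "cmod (LINT x|lborel. (h i x * h j x) *\<^sub>R W x) \<le> (LINT x|lborel. norm ((h i x * h j x) *\<^sub>R W x))"
    by (rule integral_norm_bound)
  also have "\<dots> \<le> (LINT x|lborel. B * \<bar>h i x * h j x\<bar>)"
    by (rule integral_mono[OF integrable_norm[OF int'] int le])
  finally show "cmod (LINT x|lborel. (h i x * h j x) *\<^sub>R W x) \<le> B * (LINT x|lborel. \<bar>h i x * h j x\<bar>)"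
    by simp
qed

section \<open>Decay of the difference matrix\<close>

text \<open>The ladder relations cancel the terms with \<open>x\<close> in each product. Either
  product alone leaves different coefficients on \<open>h i * h j\<close> and
  \<open>h (Suc i) * h (Suc j)\<close>; the symmetric sum makes them equal.\<close>

lemma hermite_basis_diff_eq:
  assumes h: "hermite_basis h" and i: "i \<ge> 1" and j: "j \<ge> 1"
  shows "((\<lambda>x. h i x * h (Suc j) x + h (Suc i) x * h j x) has_real_derivative
     (sqrt (2 * real i) + sqrt (2 * real j)) * (h i x * h j x - h (Suc i) x * h (Suc j) x)) (at x)"
  by (rule derivative_eq_intros hermite_basis_ladder h i j refl)+ (simp add: algebra_simps)

lemma powr_le_one_plus:
  fixes t p :: real
  assumes "t \<ge> 0" "0 \<le> p" "p \<le> 1"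
  shows "t powr p \<le> 1 + t"
proof -
  have "t powr p \<le> (1 + t) powr p" using assms by (intro powr_mono2) auto
  also have "\<dots> \<le> (1 + t) powr 1" using assms by (intro powr_mono) auto
  finally show ?thesis using assms by simp
qed

text \<open>Writing the square of \<open>1 + \<bar>x\<bar>\<close> as \<open>a * t\<close> extracts
  the power of \<open>a\<close>, and \<open>t powr \<delta> \<le> 1 + t\<close> leaves a quadratic
  whose mean against the square of \<open>h a\<close> is bounded uniformly in
  \<open>a\<close>.\<close>

lemma weighted_square_le:
  assumes "a \<ge> 1" "0 \<le> \<delta>" "\<delta> \<le> 1"
  shows "(1 + \<bar>x\<bar>) powr (2 * \<delta>) \<le> real a powr \<delta> * (3 + 2 * x\<^sup>2 / real a)"
proof -
  define t where "t = (1 + \<bar>x\<bar>)\<^sup>2 / real a"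
  have a: "real a \<ge> 1" using assms by simp
  have "(1 + \<bar>x\<bar>) powr (2 * \<delta>) = ((1 + \<bar>x\<bar>) powr 2) powr \<delta>"
    by (rule powr_powr[symmetric])
  also have "(1 + \<bar>x\<bar>) powr 2 = real a * t" using a by (simp add: t_def powr_numeral)
  also have "(real a * t) powr \<delta> = real a powr \<delta> * t powr \<delta>"
    by (rule powr_mult; simp add: t_def)
  also have "\<dots> \<le> real a powr \<delta> * (1 + t)"
    using assms by (intro mult_left_mono powr_le_one_plus) (auto simp: t_def)
  also have "\<dots> \<le> real a powr \<delta> * (3 + 2 * x\<^sup>2 / real a)"
  proof (intro mult_left_mono)
    have "(1 + \<bar>x\<bar>)\<^sup>2 \<le> 2 + 2 * x\<^sup>2"
      using zero_le_power2[of "1 - \<bar>x\<bar>"] by (simp add: power2_eq_square algebra_simps)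
    then have "t \<le> (2 + 2 * x\<^sup>2) / real a" unfolding t_def using a by (intro divide_right_mono) auto
    also have "\<dots> = 2 / real a + 2 * x\<^sup>2 / real a" by (simp add: add_divide_distrib)
    also have "2 / real a \<le> 2" using a by (simp add: field_simps)
    finally show "1 + t \<le> 3 + 2 * x\<^sup>2 / real a" by simp
  qed simp
  finally show ?thesis .
qed

text \<open>The arithmetic-geometric mean inequality is applied with the whole weight on
  \<open>h a\<close>, so that only the second moment of \<open>h a\<close> enters. The bound is free
  of \<open>b\<close>, and by symmetry the smaller index may play the part of
  \<open>a\<close>.\<close>

lemma hermite_basis_weighted_inner_le:
  assumes h: "hermite_basis h" and a: "a \<ge> 1" and b: "b \<ge> 1" and \<delta>: "0 \<le> \<delta>" "\<delta> \<le> 1"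
  shows "integrable lborel (\<lambda>x. (1 + \<bar>x\<bar>) powr \<delta> * \<bar>h a x * h b x\<bar>)" (is "integrable _ ?f")
    and "(LINT x|lborel. (1 + \<bar>x\<bar>) powr \<delta> * \<bar>h a x * h b x\<bar>) \<le> 4 * real a powr (\<delta> / 2)"
proof -
  define A where "A = real a powr (\<delta> / 2)"
  have A: "A > 0" "real a powr \<delta> = A * A" using a by (simp_all add: A_def flip: powr_add)
  define m where "m x = A / 2 * (3 * (h a x)\<^sup>2 + 2 / real a * (x\<^sup>2 * (h a x)\<^sup>2) + (h b x)\<^sup>2)" for x
  have sq: "integrable lborel (\<lambda>x. (h i x)\<^sup>2)" "(LINT x|lborel. (h i x)\<^sup>2) = 1" if "i \<ge> 1" for i
    using h that unfolding hermite_basis_def by auto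
  have le: "?f x \<le> m x" for x
  proof -
    define w where "w = (1 + \<bar>x\<bar>) powr \<delta>"
    have w2: "w\<^sup>2 \<le> A * A * (3 + 2 * x\<^sup>2 / real a)"
      using weighted_square_le[OF a \<delta>, of x] by (simp add: w_def A(2) power2_eq_square flip: powr_add)
    have "w * \<bar>h a x * h b x\<bar> = A * ((w / A * \<bar>h a x\<bar>) * \<bar>h b x\<bar>)"
      using A by (simp add: abs_mult)
    also have "\<dots> \<le> A * (((w / A * \<bar>h a x\<bar>)\<^sup>2 + \<bar>h b x\<bar>\<^sup>2) / 2)"
      using sum_squares_bound[of "w / A * \<bar>h a x\<bar>" "\<bar>h b x\<bar>"] A
      by (intro mult_left_mono) (auto simp: mult_ac)
    also have "\<dots> = A / 2 * (w\<^sup>2 / (A * A) * (h a x)\<^sup>2 + (h b x)\<^sup>2)"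
      using A by (simp add: power_mult_distrib power_divide power2_eq_square[of A])
    also have "\<dots> \<le> A / 2 * ((3 + 2 * x\<^sup>2 / real a) * (h a x)\<^sup>2 + (h b x)\<^sup>2)"
      using w2 A by (intro mult_left_mono add_right_mono mult_right_mono) (auto simp: divide_simps mult_ac)
    also have "\<dots> = m x" by (simp add: m_def algebra_simps)
    finally show ?thesis by (simp add: w_def)
  qed
  have int_m: "integrable lborel m"
    unfolding m_def using sq a b hermite_basis_second_moment[OF h a]
    by (intro integrable_mult_right Bochner_Integration.integrable_add) auto
  have "(LINT x|lborel. m x) = A / 2 * (3 + 2 / real a * (LINT x|lborel. x\<^sup>2 * (h a x)\<^sup>2) + 1)"
    unfolding m_def using sq a b hermite_basis_second_moment[OF h a] by simp
  \<comment> \<open>The middle term is at most 4, so the bracket is at most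
    \<open>3 + 4 + 1 = 8\<close>.\<close>
  also have "2 / real a * (LINT x|lborel. x\<^sup>2 * (h a x)\<^sup>2) \<le> 2 / real a * (2 * real a - 1)"
    using hermite_basis_second_moment[OF h a] by (intro mult_left_mono) auto
  also have "\<dots> \<le> 4" using a by (simp add: field_simps)
  finally have LINT_m: "(LINT x|lborel. m x) \<le> 4 * A" using A by (simp add: mult_left_mono)
  note cont = hermite_basis_continuous[OF h]
  have "continuous_on UNIV ?f"
    by (intro continuous_intros cont a b) auto
  then have "?f \<in> borel_measurable borel" by (rule borel_measurable_continuous_onI)
  then show int: "integrable lborel ?f"
    using le by (intro Bochner_Integration.integrable_bound[OF int_m])
       (auto intro!: AE_I2 intro: order_trans[OF le abs_ge_self])
  have "(LINT x|lborel. ?f x) \<le> (LINT x|lborel. m x)"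
    by (rule integral_mono[OF int int_m le])
  then show "(LINT x|lborel. ?f x) \<le> 4 * real a powr (\<delta> / 2)"
    using LINT_m by (simp add: A_def)
qed

text \<open>Integration by parts against the symmetric sum costs \<open>min i j\<close> to the power
  \<delta>/2 from the growth of \<open>W'\<close> and gains its square root from the factor
  \<open>s\<close>.\<close>

lemma diff_potential_entry_le:
  fixes W W' :: "real \<Rightarrow> complex"
  assumes h: "hermite_basis h" and ij: "i \<ge> 1" "j \<ge> 1" and \<delta>: "0 \<le> \<delta>" "\<delta> \<le> 1"
    and W: "\<And>x. (W has_vector_derivative W' x) (at x)"
    and B: "\<And>x. cmod (W x) \<le> B"
    and C: "C \<ge> 0" "\<And>x. cmod (W' x) \<le> C * (1 + \<bar>x\<bar>) powr \<delta>"
  shows "cmod ((LINT x|lborel. (h (Suc i) x * h (Suc j) x) *\<^sub>R W x)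
        - (LINT x|lborel. (h i x * h j x) *\<^sub>R W x))
     \<le> 8 * C * real (min i j) powr (- ((1 - \<delta>) / 2))"
proof -
  define s where "s = sqrt (2 * real i) + sqrt (2 * real j)"
  define m where "m = min i j"
  have m: "m \<ge> 1" using ij by (simp add: m_def)
  define g where "g x = h i x * h (Suc j) x + h (Suc i) x * h j x" for x
  define g' where "g' x = s * (h i x * h j x - h (Suc i) x * h (Suc j) x)" for x
  define w where "w x = (1 + \<bar>x\<bar>) powr \<delta>" for x :: real
  have g: "(g has_real_derivative g' x) (at x)" for x
    unfolding g_def[abs_def] g'_def s_def by (rule hermite_basis_diff_eq[OF h ij])
  have Suc: "Suc i \<ge> 1" "Suc j \<ge> 1" by auto
  have g'_int: "integrable lborel g'"
    unfolding g'_def using hermite_basis_mult_integrable[OF h] ij Suc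
    by (intro integrable_mult_right Bochner_Integration.integrable_diff) auto
  note cont = hermite_basis_continuous[OF h]
  have contW: "continuous_on UNIV W"
    using W by (meson continuous_at_imp_continuous_on has_vector_derivative_continuous)
  have g'_cont: "continuous_on UNIV g'"
    unfolding g'_def by (intro continuous_intros cont ij Suc)
  have m_cont: "continuous_on UNIV (\<lambda>x. C * (w x * \<bar>h i x * h (Suc j) x\<bar> + w x * \<bar>h (Suc i) x * h j x\<bar>))"
    unfolding w_def by (intro continuous_intros cont ij Suc) auto
  have lim: "((\<lambda>x. h a x * h b x) \<longlongrightarrow> 0) at_top" "((\<lambda>x. h a x * h b x) \<longlongrightarrow> 0) at_bot"
    if ab: "a \<ge> 1" "b \<ge> 1" for a b
    using hermite_basis_mult_gauss[OF h ab] gauss_tendsto_0 by auto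
  have g_lim: "(g \<longlongrightarrow> 0) at_top" "(g \<longlongrightarrow> 0) at_bot"
    unfolding g_def[abs_def] by (rule tendsto_add_zero; intro lim ij Suc)+
  have w_int: "integrable lborel (\<lambda>x. w x * \<bar>h a x * h b x\<bar>)"
    and w_le: "(LINT x|lborel. w x * \<bar>h a x * h b x\<bar>) \<le> 4 * real a powr (\<delta> / 2)"
    if "a \<ge> 1" "b \<ge> 1" for a b
    unfolding w_def using hermite_basis_weighted_inner_le[OF h that \<delta>] by auto
  have w_le': "(LINT x|lborel. w x * \<bar>h a x * h b x\<bar>) \<le> 4 * real b powr (\<delta> / 2)"
    if "a \<ge> 1" "b \<ge> 1" for a b
    using w_le[OF that(2,1)] by (simp add: mult.commute)
  have le8: "(LINT x|lborel. w x * \<bar>h a x * h b x\<bar>) \<le> 8 * real m powr (\<delta> / 2)"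
    if ab: "a \<ge> 1" "b \<ge> 1" and "min a b \<le> Suc m" for a b
  proof -
    have "(LINT x|lborel. w x * \<bar>h a x * h b x\<bar>) \<le> 4 * real (min a b) powr (\<delta> / 2)"
      using w_le[OF ab] w_le'[OF ab] by (simp add: min_def)
    \<comment> \<open>The shifted index is at most \<open>m + 1 \<le> 2 * m\<close>; this costs a
      factor \<open>2 powr (\<delta> / 2) \<le> 2\<close>, which turns 4 into 8.\<close>
    also have "\<dots> \<le> 4 * (2 * real m) powr (\<delta> / 2)"
      using that(3) m \<delta> by (intro mult_left_mono powr_mono2) auto
    also have "(2 * real m) powr (\<delta> / 2) = 2 powr (\<delta> / 2) * real m powr (\<delta> / 2)"
      by (simp add: powr_mult)
    also have "\<dots> \<le> 2 powr 1 * real m powr (\<delta> / 2)"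
      using \<delta> by (intro mult_right_mono powr_mono) auto
    finally show ?thesis by simp
  qed
  have "cmod (LINT x|lborel. g' x *\<^sub>R W x)
      \<le> (LINT x|lborel. C * (w x * \<bar>h i x * h (Suc j) x\<bar> + w x * \<bar>h (Suc i) x * h j x\<bar>))"
  proof (rule norm_integral_deriv_mult_le[OF W B g g'_cont m_cont g'_int _ g_lim])
    show "integrable lborel (\<lambda>x. C * (w x * \<bar>h i x * h (Suc j) x\<bar> + w x * \<bar>h (Suc i) x * h j x\<bar>))"
      using w_int ij Suc by (intro integrable_mult_right Bochner_Integration.integrable_add) auto
    fix x
    have "cmod (W' x) * \<bar>g x\<bar> \<le> (C * w x) * (\<bar>h i x * h (Suc j) x\<bar> + \<bar>h (Suc i) x * h j x\<bar>)"
      using C(2)[of x] by (intro mult_mono) (auto simp: w_def g_def C(1))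
    then show "cmod (W' x) * \<bar>g x\<bar> \<le> C * (w x * \<bar>h i x * h (Suc j) x\<bar> + w x * \<bar>h (Suc i) x * h j x\<bar>)"
      by (simp add: algebra_simps)
  qed
  also have "\<dots> = C * ((LINT x|lborel. w x * \<bar>h i x * h (Suc j) x\<bar>)
      + (LINT x|lborel. w x * \<bar>h (Suc i) x * h j x\<bar>))"
    using w_int ij Suc by simp
  also have "\<dots> \<le> C * (8 * real m powr (\<delta> / 2) + 8 * real m powr (\<delta> / 2))"
    using C(1) ij by (intro mult_left_mono add_mono le8) (auto simp: m_def)
  finally have G: "cmod (LINT x|lborel. g' x *\<^sub>R W x) \<le> 16 * C * real m powr (\<delta> / 2)"
    by simp
  have intW: "integrable lborel (\<lambda>x. (h a x * h b x) *\<^sub>R W x)" if "a \<ge> 1" "b \<ge> 1" for a b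
    by (rule hermite_basis_mult_bounded(1)[OF h that borel_measurable_continuous_onI[OF contW] B])
  have "(LINT x|lborel. g' x *\<^sub>R W x) =
      (LINT x|lborel. s *\<^sub>R ((h i x * h j x) *\<^sub>R W x - (h (Suc i) x * h (Suc j) x) *\<^sub>R W x))"
    by (simp only: g'_def scaleR_scaleR[symmetric] scaleR_diff_left)
  also have "\<dots> = s *\<^sub>R ((LINT x|lborel. (h i x * h j x) *\<^sub>R W x)
      - (LINT x|lborel. (h (Suc i) x * h (Suc j) x) *\<^sub>R W x))"
    by (simp only: integral_scaleR_right Bochner_Integration.integral_diff[OF intW[OF ij] intW[OF Suc]])
  finally have "s * cmod ((LINT x|lborel. (h (Suc i) x * h (Suc j) x) *\<^sub>R W x)
        - (LINT x|lborel. (h i x * h j x) *\<^sub>R W x))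
      \<le> 16 * C * real m powr (\<delta> / 2)" (is "s * ?D \<le> _")
    using G by (simp add: norm_minus_commute s_def)
  \<comment> \<open>Dividing by this lower bound turns 16 into 8 and lowers the exponent by
    1/2.\<close>
  moreover have "2 * sqrt (real m) \<le> s"
  proof -
    have "sqrt (real m) \<le> sqrt (2 * real i)" "sqrt (real m) \<le> sqrt (2 * real j)"
      by (auto simp: m_def)
    then show ?thesis unfolding s_def by linarith
  qed
  then have "2 * sqrt (real m) * ?D \<le> s * ?D"
    by (rule mult_right_mono) simp
  ultimately have "2 * sqrt (real m) * ?D \<le> 16 * C * real m powr (\<delta> / 2)"
    by linarith
  then have "?D \<le> 8 * C * (real m powr (\<delta> / 2) / sqrt (real m))"
    using m by (simp add: field_simps)
  also have "real m powr (\<delta> / 2) / sqrt (real m) = real m powr (\<delta> / 2 - 1 / 2)"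
    using m by (simp add: powr_diff powr_half_sqrt)
  also have "\<delta> / 2 - 1 / 2 = - ((1 - \<delta>) / 2)"
    by (simp add: field_simps)
  finally show ?thesis by (simp add: m_def)
qed

section \<open>Cauchy estimates on the strip\<close>

text \<open>Cauchy's inequality on the circle of radius \<open>R / 2\<close> bounds the derivative
  at 0; the first-order Taylor formula from 0 to 1 reduces the remainder to a bound for the second
  derivative on the unit disc.\<close>

lemma Cauchy_estimates_disc:
  fixes \<phi> :: "complex \<Rightarrow> complex"
  assumes hol: "\<phi> holomorphic_on ball 0 R" and B: "\<And>z. z \<in> ball 0 R \<Longrightarrow> cmod (\<phi> z) \<le> B" and R: "R > 0"
  shows "cmod (deriv \<phi> 0) \<le> 2 * B / R"
    and "R \<ge> 2 \<Longrightarrow> cmod (\<phi> 1 - \<phi> 0 - deriv \<phi> 0) \<le> 32 * B / R\<^sup>2"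
proof -
  have est: "cmod ((deriv ^^ n) \<phi> z) \<le> fact n * B / r ^ n"
    if "r > 0" "cmod z + r < R" for n z r
  proof (rule Cauchy_inequality)
    have sub: "cball z r \<subseteq> ball 0 R"
    proof
      fix y assume "y \<in> cball z r"
      then show "y \<in> ball 0 R"
        using that norm_triangle_ineq2[of y z] by (auto simp: dist_norm norm_minus_commute)
    qed
    show "\<phi> holomorphic_on ball z r" using sub hol holomorphic_on_subset ball_subset_cball by blast
    show "continuous_on (cball z r) \<phi>"
      using sub hol holomorphic_on_subset holomorphic_on_imp_continuous_on by blast
    show "cmod (\<phi> y) \<le> B" if "cmod (z - y) = r" for y
      using sub that by (intro B) (auto simp: dist_norm subset_iff)
  qed fact
  show "cmod (deriv \<phi> 0) \<le> 2 * B / R"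
    using est[of "R / 2" 0 1] R by (simp add: field_simps)
  show "cmod (\<phi> 1 - \<phi> 0 - deriv \<phi> 0) \<le> 32 * B / R\<^sup>2" if "R \<ge> 2"
  proof -
    have "cmod ((deriv ^^ 0) \<phi> 1 - (\<Sum>i\<le>1. (deriv ^^ i) \<phi> 0 * (1 - 0) ^ i / fact i))
        \<le> (32 * B / R\<^sup>2) * cmod (1 - 0) ^ Suc 1 / fact 1"
    proof (rule complex_Taylor[where S="cball 0 1"])
      fix i :: nat and z :: complex assume z: "z \<in> cball 0 1"
      have "(deriv ^^ i) \<phi> holomorphic_on ball 0 R"
        using hol by (rule holomorphic_higher_deriv) simp
      then have "((deriv ^^ i) \<phi> has_field_derivative (deriv ^^ Suc i) \<phi> z) (at z)"
        using z that by (auto intro!: holomorphic_derivI[of _ "ball 0 R"])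
      then show "((deriv ^^ i) \<phi> has_field_derivative (deriv ^^ Suc i) \<phi> z) (at z within cball 0 1)"
        by (rule has_field_derivative_at_within)
      \<comment> \<open>Since \<open>1 + R / 4 < R\<close> for \<open>R \<ge> 2\<close>, circles of
        radius \<open>R / 4\<close> about points of the unit disc stay inside, and
        \<open>2 * B / (R / 4)\<^sup>2 = 32 * B / R\<^sup>2\<close>.\<close>
      show "cmod ((deriv ^^ Suc 1) \<phi> z) \<le> 32 * B / R\<^sup>2"
        using est[of "R / 4" z 2] z that by (simp add: power2_eq_square numeral_2_eq_2)
    qed auto
    then show ?thesis by (simp add: algebra_simps)
  qed
qed

lemma norm_vector_scalar_mult: "norm (c *s v) = cmod c * norm v" for v :: "complex ^ 'n"
  by (simp add: norm_vec_def norm_mult L2_set_right_distrib)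

text \<open>Restriction to the complex line through \<theta>\<open>\<^sub>0\<close> in direction
  \<open>v\<close> reduces this to a disc of radius \<open>R = r / norm v\<close>; the parameter
  value 1 is the point displaced by \<open>v\<close>.\<close>

lemma Cauchy_estimates_Cn:
  fixes f :: "complex ^ 'n \<Rightarrow> complex"
  assumes hol: "\<And>\<theta>. \<theta> \<in> ball \<theta>\<^sub>0 r \<Longrightarrow> \<exists>f'. (f has_derivative f') (at \<theta>) \<and> (\<forall>c v. f' (c *s v) = c * f' v)"
    and B: "\<And>\<theta>. \<theta> \<in> ball \<theta>\<^sub>0 r \<Longrightarrow> cmod (f \<theta>) \<le> B" and r: "r > 0"
    and f': "(f has_derivative f') (at \<theta>\<^sub>0)"
  shows "cmod (f' v) \<le> 2 * B / r * norm v"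
    and "norm v \<le> r / 2 \<Longrightarrow> cmod (f (\<theta>\<^sub>0 + v) - f \<theta>\<^sub>0 - f' v) \<le> 32 * B / r\<^sup>2 * (norm v)\<^sup>2"
proof -
  \<comment> \<open>The given derivative is only known to be real-linear; uniqueness identifies it
    with a complex-linear one.\<close>
  obtain f'' where f'': "(f has_derivative f'') (at \<theta>\<^sub>0)" "\<And>c v. f'' (c *s v) = c * f'' v"
    using hol[of \<theta>\<^sub>0] r by auto
  have "f' = f''" using f' f''(1) by (rule has_derivative_unique)
  have zero: "f' 0 = 0"
    using f' has_derivative_zero_unique by (metis has_derivative_bounded_linear linear_simps(3))
  have "cmod (f' v) \<le> 2 * B / r * norm v \<and>
      (norm v \<le> r / 2 \<longrightarrow> cmod (f (\<theta>\<^sub>0 + v) - f \<theta>\<^sub>0 - f' v) \<le> 32 * B / r\<^sup>2 * (norm v)\<^sup>2)"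
  proof (cases "v = 0")
    case True
    then show ?thesis by (simp add: zero)
  next
    case False
    define R where "R = r / norm v"
    have "R > 0" using False r by (simp add: R_def)
    define \<phi> where "\<phi> z = f (\<theta>\<^sub>0 + z *s v)" for z
    have in_ball: "\<theta>\<^sub>0 + z *s v \<in> ball \<theta>\<^sub>0 r" if "z \<in> ball 0 R" for z
      using that False by (simp add: dist_norm norm_vector_scalar_mult R_def field_simps)
    have lin: "bounded_linear (\<lambda>z. z *s v)"
      by (rule bounded_linear_intro[where K="norm v"])
         (auto simp: vec_eq_iff algebra_simps norm_vector_scalar_mult)
    have \<phi>_deriv: "(\<phi> has_field_derivative g v) (at z)"
      if g: "(f has_derivative g) (at (\<theta>\<^sub>0 + z *s v))" "\<And>c v. g (c *s v) = c * g v" for g z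
    proof -
      have "((\<lambda>z. \<theta>\<^sub>0 + z *s v) has_derivative (\<lambda>z. z *s v)) (at z)"
        using has_derivative_add[OF has_derivative_const bounded_linear_imp_has_derivative[OF lin]] by simp
      from diff_chain_at[OF this g(1)]
      have "(\<phi> has_derivative (\<lambda>z. z * g v)) (at z)"
        by (simp add: \<phi>_def[abs_def] o_def g(2))
      moreover have "(\<lambda>z. z * g v) = (*) (g v)" by (simp add: fun_eq_iff mult.commute)
      ultimately show ?thesis by (simp add: has_field_derivative_def)
    qed
    have "\<phi> holomorphic_on ball 0 R"
      using hol[OF in_ball] \<phi>_deriv unfolding holomorphic_on_open[OF open_ball] by blast
    moreover have "cmod (\<phi> z) \<le> B" if "z \<in> ball 0 R" for z
      unfolding \<phi>_def using in_ball[OF that] by (rule B)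
    moreover have "deriv \<phi> 0 = f' v"
      using \<phi>_deriv[of f'' 0] f'' by (auto simp: \<open>f' = f''\<close> intro: DERIV_imp_deriv)
    ultimately have "cmod (f' v) \<le> 2 * B / R"
      "R \<ge> 2 \<Longrightarrow> cmod (f (\<theta>\<^sub>0 + v) - f \<theta>\<^sub>0 - f' v) \<le> 32 * B / R\<^sup>2"
      using Cauchy_estimates_disc[of \<phi> R B] \<open>R > 0\<close> by (auto simp: \<phi>_def)
    moreover have "R \<ge> 2" if "norm v \<le> r / 2" using that False by (simp add: R_def field_simps)
    ultimately show ?thesis using False by (simp add: R_def power_divide)
  qed
  then show "cmod (f' v) \<le> 2 * B / r * norm v"
    and "norm v \<le> r / 2 \<Longrightarrow> cmod (f (\<theta>\<^sub>0 + v) - f \<theta>\<^sub>0 - f' v) \<le> 32 * B / r\<^sup>2 * (norm v)\<^sup>2"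
    by auto
qed

text \<open>Taking imaginary parts does not increase the Euclidean norm, so the distance left to
  \<sigma> serves as radius.\<close>

lemma strip_contains_ball:
  fixes \<theta>\<^sub>0 :: "complex ^ 'n"
  assumes "\<theta>\<^sub>0 \<in> strip \<sigma>"
  shows "\<exists>r>0. ball \<theta>\<^sub>0 r \<subseteq> strip \<sigma>"
proof (intro exI conjI subsetI)
  let ?im = "\<lambda>\<theta> :: complex ^ 'n. \<chi> i. Im (\<theta> $ i)"
  show "\<sigma> - norm (?im \<theta>\<^sub>0) > 0" using assms by (simp add: strip_def)
  fix \<theta> assume "\<theta> \<in> ball \<theta>\<^sub>0 (\<sigma> - norm (?im \<theta>\<^sub>0))"
  then have "norm (\<theta> - \<theta>\<^sub>0) < \<sigma> - norm (?im \<theta>\<^sub>0)" by (simp add: dist_norm norm_minus_commute)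
  moreover have "norm (?im (\<theta> - \<theta>\<^sub>0)) \<le> norm (\<theta> - \<theta>\<^sub>0)"
    unfolding norm_vec_def by (intro L2_set_mono) (auto simp del: minus_complex.sel intro: abs_Im_le_cmod)
  moreover have "?im \<theta> = ?im \<theta>\<^sub>0 + ?im (\<theta> - \<theta>\<^sub>0)" by (simp add: vec_eq_iff)
  then have "norm (?im \<theta>) \<le> norm (?im \<theta>\<^sub>0) + norm (?im (\<theta> - \<theta>\<^sub>0))" by (metis norm_triangle_ineq)
  ultimately show "\<theta> \<in> strip \<sigma>" by (simp add: strip_def)
qed

section \<open>Operator bounds for multiplication\<close>

text \<open>Testing the sections on \<open>u = cnj (M i)\<close> bounds every row of \<open>M\<close> in \<open>\<ell>\<^sup>2\<close>, so that \<open>M u\<close> is defined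
  entrywise and is controlled as a limit of sections.\<close>

lemma bounded_mats_if_sections:
  fixes M :: inf_matrix
  assumes B: "B \<ge> 0"
    and sec: "\<And>I J u. finite I \<Longrightarrow> finite J \<Longrightarrow> I \<subseteq> {1..} \<Longrightarrow> J \<subseteq> {1..} \<Longrightarrow>
      (\<Sum>i\<in>I. (cmod (\<Sum>j\<in>J. M i j * u j))\<^sup>2) \<le> B\<^sup>2 * (\<Sum>j\<in>J. (cmod (u j))\<^sup>2)"
  shows "M \<in> bounded_mats" and "0 \<le> op_norm M" and "op_norm M \<le> B"
proof -
  have row: "(\<lambda>j. (cmod (M i j))\<^sup>2) summable_on {1..}" if "i \<ge> 1" for i
  proof (rule nonneg_bdd_above_summable_on)
    show "bdd_above (sum (\<lambda>j. (cmod (M i j))\<^sup>2) ` {F. F \<subseteq> {1..} \<and> finite F})"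
    proof (rule bdd_aboveI2)
      fix J :: "nat set" assume J: "J \<in> {F. F \<subseteq> {1..} \<and> finite F}"
      define s where "s = (\<Sum>j\<in>J. (cmod (M i j))\<^sup>2)"
      have "(\<Sum>j\<in>J. M i j * cnj (M i j)) = of_real s"
        unfolding s_def of_real_sum by (intro sum.cong refl complex_norm_square[symmetric])
      then have "s * s \<le> B\<^sup>2 * s"
        using sec[of "{i}" J "\<lambda>j. cnj (M i j)"] J that
        by (simp add: s_def power2_eq_square[of "sum _ _"] del: of_real_sum)
      moreover have "s \<ge> 0" by (simp add: s_def sum_nonneg)
      ultimately have "s \<le> B\<^sup>2" by (cases "s = 0") auto
      then show "(\<Sum>j\<in>J. (cmod (M i j))\<^sup>2) \<le> B\<^sup>2" by (simp add: s_def)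
    qed
  qed simp
  have sums: "(\<lambda>j. M i j * u j) summable_on {1..}" if "i \<ge> 1" "u \<in> ell2" for i u
  proof (rule abs_summable_summable, rule summable_on_comparison_test)
    show "(\<lambda>j. (cmod (M i j))\<^sup>2 + (cmod (u j))\<^sup>2) summable_on {1..}"
      using row[OF that(1)] that(2) unfolding ell2_def by (intro summable_on_add) auto
    show "norm (M i j * u j) \<le> (cmod (M i j))\<^sup>2 + (cmod (u j))\<^sup>2" for j
    proof -
      have "cmod (M i j) * cmod (u j) \<ge> 0" by simp
      then show ?thesis
        using sum_squares_bound[of "cmod (M i j)" "cmod (u j)"] unfolding norm_mult by linarith
    qed
  qed simp
  have fin: "(\<Sum>i\<in>I. (cmod (mat_apply M u i))\<^sup>2) \<le> B\<^sup>2 * (\<Sum>\<^sub>\<infinity>j\<in>{1..}. (cmod (u j))\<^sup>2)"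
    if I: "finite I" "I \<subseteq> {1..}" and u: "u \<in> ell2" for I u
  proof (rule tendsto_upperbound)
    show "((\<lambda>J. \<Sum>i\<in>I. (cmod (\<Sum>j\<in>J. M i j * u j))\<^sup>2) \<longlongrightarrow> (\<Sum>i\<in>I. (cmod (mat_apply M u i))\<^sup>2))
      (finite_subsets_at_top {1..})"
    proof (intro tendsto_sum tendsto_power tendsto_norm)
      fix i assume "i \<in> I"
      then have "((\<lambda>j. M i j * u j) has_sum mat_apply M u i) {1..}"
        unfolding mat_apply_def using I by (intro has_sum_infsum sums u) auto
      then show "((\<lambda>J. \<Sum>j\<in>J. M i j * u j) \<longlongrightarrow> mat_apply M u i) (finite_subsets_at_top {1..})"
        by (simp add: has_sum_def)
    qed
    show "\<forall>\<^sub>F J in finite_subsets_at_top {1..}. (\<Sum>i\<in>I. (cmod (\<Sum>j\<in>J. M i j * u j))\<^sup>2)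
        \<le> B\<^sup>2 * (\<Sum>\<^sub>\<infinity>j\<in>{1..}. (cmod (u j))\<^sup>2)"
    proof (rule eventually_finite_subsets_at_top_weakI)
      fix J :: "nat set" assume J: "finite J" "J \<subseteq> {1..}"
      have "(\<Sum>j\<in>J. (cmod (u j))\<^sup>2) \<le> (\<Sum>\<^sub>\<infinity>j\<in>{1..}. (cmod (u j))\<^sup>2)"
        using J u by (intro finite_sum_le_infsum) (auto simp: ell2_def)
      then show "(\<Sum>i\<in>I. (cmod (\<Sum>j\<in>J. M i j * u j))\<^sup>2) \<le> B\<^sup>2 * (\<Sum>\<^sub>\<infinity>j\<in>{1..}. (cmod (u j))\<^sup>2)"
        using sec[OF I(1) J(1) I(2) J(2), of u] B by (meson mult_left_mono order_trans zero_le_power)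
    qed
  qed simp
  have mem: "mat_apply M u \<in> ell2" if "u \<in> ell2" for u
    unfolding ell2_def mem_Collect_eq
    by (rule nonneg_bdd_above_summable_on)
       (use fin that in \<open>auto intro!: bdd_aboveI2[where M="B\<^sup>2 * (\<Sum>\<^sub>\<infinity>j\<in>{1..}. (cmod (u j))\<^sup>2)"]\<close>)
  have bound: "ell2_norm (mat_apply M u) \<le> B * ell2_norm u" if "u \<in> ell2" for u
  proof -
    have "(\<Sum>\<^sub>\<infinity>i\<in>{1..}. (cmod (mat_apply M u i))\<^sup>2) \<le> B\<^sup>2 * (\<Sum>\<^sub>\<infinity>j\<in>{1..}. (cmod (u j))\<^sup>2)"
      using mem[OF that] fin[OF _ _ that] by (intro infsum_le_finite_sums) (auto simp: ell2_def)
    then have "ell2_norm (mat_apply M u) \<le> sqrt (B\<^sup>2 * (\<Sum>\<^sub>\<infinity>j\<in>{1..}. (cmod (u j))\<^sup>2))"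
      unfolding ell2_norm_def by (rule real_sqrt_le_mono)
    then show ?thesis using B by (simp add: ell2_norm_def real_sqrt_mult)
  qed
  show "M \<in> bounded_mats"
    unfolding bounded_mats_def using sums mem bound by blast
  let ?S = "{ell2_norm (mat_apply M u) | u. u \<in> ell2 \<and> ell2_norm u \<le> 1}"
  have le_B: "y \<le> B" if "y \<in> ?S" for y
  proof -
    obtain u where u: "u \<in> ell2" "ell2_norm u \<le> 1" "y = ell2_norm (mat_apply M u)"
      using \<open>y \<in> ?S\<close> by blast
    have "B * ell2_norm u \<le> B * 1" using u B by (intro mult_left_mono)
    then show ?thesis using bound[OF u(1)] u(3) by simp
  qed
  \<comment> \<open>The zero sequence makes the set nonempty and gives the lower bound for its
    supremum.\<close>
  have zero: "0 \<in> ?S"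
    by (rule CollectI, rule exI[of _ "\<lambda>_. 0"]) (auto simp: ell2_norm_def mat_apply_def ell2_def)
  show "op_norm M \<le> B" unfolding op_norm_def
    using zero le_B by (intro cSup_least) auto
  show "0 \<le> op_norm M" unfolding op_norm_def
    using zero le_B by (intro cSup_upper bdd_aboveI) auto
qed

text \<open>The squared modulus expands into products of two basis functions, and orthonormality
  keeps the diagonal. Finite combinations are what testing on finite sections produces.\<close>

lemma hermite_basis_Parseval:
  assumes h: "hermite_basis h" and J: "finite J" "J \<subseteq> {1..}"
  shows "integrable lborel (\<lambda>x. (cmod (\<Sum>j\<in>J. h j x *\<^sub>R u j))\<^sup>2)"
    and "(LINT x|lborel. (cmod (\<Sum>j\<in>J. h j x *\<^sub>R u j))\<^sup>2) = (\<Sum>j\<in>J. (cmod (u j))\<^sup>2)"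
proof -
  have eq: "(cmod (\<Sum>j\<in>J. h j x *\<^sub>R u j))\<^sup>2 = (\<Sum>j\<in>J. \<Sum>k\<in>J. (h j x * h k x) * Re (u j * cnj (u k)))" for x
  proof -
    have "(cmod (\<Sum>j\<in>J. h j x *\<^sub>R u j))\<^sup>2 = Re ((\<Sum>j\<in>J. h j x *\<^sub>R u j) * cnj (\<Sum>j\<in>J. h j x *\<^sub>R u j))"
      by (subst complex_norm_square[symmetric]) simp
    also have "\<dots> = Re (\<Sum>j\<in>J. \<Sum>k\<in>J. (h j x * h k x) *\<^sub>R (u j * cnj (u k)))"
      unfolding cnj_sum sum_product by (intro arg_cong[where f=Re] sum.cong refl) (simp add: scaleR_conv_of_real)
    finally show ?thesis by (simp only: Re_sum scaleR_complex.sel)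
  qed
  have int: "integrable lborel (\<lambda>x. (h j x * h k x) * Re (u j * cnj (u k)))" if "j \<in> J" "k \<in> J" for j k
    using that J by (intro integrable_mult_left hermite_basis_mult_integrable[OF h]) auto
  show "integrable lborel (\<lambda>x. (cmod (\<Sum>j\<in>J. h j x *\<^sub>R u j))\<^sup>2)"
    unfolding eq by (intro Bochner_Integration.integrable_sum int)
  have "(LINT x|lborel. (cmod (\<Sum>j\<in>J. h j x *\<^sub>R u j))\<^sup>2) =
      (\<Sum>j\<in>J. \<Sum>k\<in>J. (LINT x|lborel. (h j x * h k x) * Re (u j * cnj (u k))))"
    unfolding eq using int
    by (subst Bochner_Integration.integral_sum;
        (intro sum.cong refl Bochner_Integration.integral_sum
          Bochner_Integration.integrable_sum)?) auto
  also have "\<dots> = (\<Sum>j\<in>J. \<Sum>k\<in>J. of_bool (j = k) * Re (u j * cnj (u k)))"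
  proof (intro sum.cong refl)
    fix j k assume "j \<in> J" "k \<in> J"
    then have "j \<ge> 1" "k \<ge> 1" using J by auto
    then show "(LINT x|lborel. (h j x * h k x) * Re (u j * cnj (u k))) = of_bool (j = k) * Re (u j * cnj (u k))"
      using hermite_basis_orthonormal[OF h, of j k] by (simp only: integral_mult_left_zero)
  qed
  also have "\<dots> = (\<Sum>j\<in>J. \<Sum>k\<in>J. if j = k then (cmod (u j))\<^sup>2 else 0)"
    by (intro sum.cong refl) (simp add: cmod_power2 power2_eq_square[of "Re _"] power2_eq_square[of "Im _"])
  also have "\<dots> = (\<Sum>j\<in>J. (cmod (u j))\<^sup>2)" using J by simp
  finally show "(LINT x|lborel. (cmod (\<Sum>j\<in>J. h j x *\<^sub>R u j))\<^sup>2) = (\<Sum>j\<in>J. (cmod (u j))\<^sup>2)" .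
qed

text \<open>Pairing \<open>W f\<close> with \<open>e = \<Sum> c\<^sub>i h\<^sub>i\<close>, where \<open>c = M u\<close> and \<open>f = \<Sum> u\<^sub>j h\<^sub>j\<close>, gives
  \<open>\<parallel>c\<parallel>\<^sup>2 \<le> \<integral> B \<bar>f\<bar> \<bar>e\<bar> \<le> (B\<^sup>2 \<parallel>u\<parallel>\<^sup>2 + \<parallel>c\<parallel>\<^sup>2) / 2\<close>.\<close>

lemma multiplication_sections_le:
  fixes W :: "real \<Rightarrow> complex" and M :: inf_matrix
  assumes h: "hermite_basis h" and W: "W \<in> borel_measurable borel" and B: "\<And>x. cmod (W x) \<le> B"
    and M: "\<And>i j. i \<ge> 1 \<Longrightarrow> j \<ge> 1 \<Longrightarrow> M i j = (LINT x|lborel. (h i x * h j x) *\<^sub>R W x)"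
    and I: "finite I" "I \<subseteq> {1..}" and J: "finite J" "J \<subseteq> {1..}"
  shows "(\<Sum>i\<in>I. (cmod (\<Sum>j\<in>J. M i j * u j))\<^sup>2) \<le> B\<^sup>2 * (\<Sum>j\<in>J. (cmod (u j))\<^sup>2)"
proof -
  define c where "c i = (\<Sum>j\<in>J. M i j * u j)" for i
  define f where "f x = (\<Sum>j\<in>J. h j x *\<^sub>R u j)" for x
  define e where "e x = (\<Sum>i\<in>I. h i x *\<^sub>R c i)" for x
  define S where "S = (\<Sum>i\<in>I. (cmod (c i))\<^sup>2)"
  define G where "G x = W x * f x * cnj (e x)" for x
  have G_eq: "G x = (\<Sum>i\<in>I. \<Sum>j\<in>J. ((h i x * h j x) *\<^sub>R W x) * (u j * cnj (c i)))" for x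
    unfolding G_def f_def e_def cnj_sum sum_distrib_left sum_distrib_right
    by (intro sum.cong refl) (simp add: scaleR_conv_of_real mult_ac)
  have int: "integrable lborel (\<lambda>x. ((h i x * h j x) *\<^sub>R W x) * (u j * cnj (c i)))" if "i \<in> I" "j \<in> J" for i j
    using that I J by (intro integrable_mult_left hermite_basis_mult_bounded(1)[OF h _ _ W B]) auto
  have intG: "integrable lborel G"
    unfolding G_eq[abs_def] by (intro Bochner_Integration.integrable_sum int)
  have "(LINT x|lborel. G x) = (\<Sum>i\<in>I. \<Sum>j\<in>J. (LINT x|lborel. ((h i x * h j x) *\<^sub>R W x) * (u j * cnj (c i))))"
    unfolding G_eq using int
    by (subst Bochner_Integration.integral_sum;
        (intro sum.cong refl Bochner_Integration.integral_sum
          Bochner_Integration.integrable_sum)?) auto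
  also have "\<dots> = (\<Sum>i\<in>I. \<Sum>j\<in>J. M i j * (u j * cnj (c i)))"
    using I J by (intro sum.cong refl) (subst integral_mult_left_zero, subst M, auto)
  also have "\<dots> = (\<Sum>i\<in>I. c i * cnj (c i))"
    by (simp add: c_def sum_distrib_right mult.assoc)
  also have "\<dots> = of_real S"
    unfolding S_def of_real_sum by (intro sum.cong refl complex_norm_square[symmetric])
  finally have "S = cmod (LINT x|lborel. G x)"
    by (simp add: S_def sum_nonneg del: of_real_sum)
  also have "\<dots> \<le> (LINT x|lborel. cmod (G x))"
    by (rule integral_norm_bound)
  also have "\<dots> \<le> (LINT x|lborel. (B\<^sup>2 * (cmod (f x))\<^sup>2 + (cmod (e x))\<^sup>2) / 2)"
  proof (rule integral_mono)
    show "integrable lborel (\<lambda>x. (B\<^sup>2 * (cmod (f x))\<^sup>2 + (cmod (e x))\<^sup>2) / 2)"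
      using hermite_basis_Parseval(1)[OF h] I J by (simp add: f_def e_def)
    show "cmod (G x) \<le> (B\<^sup>2 * (cmod (f x))\<^sup>2 + (cmod (e x))\<^sup>2) / 2" for x
    proof -
      have "cmod (G x) \<le> B * cmod (f x) * cmod (e x)"
        using B[of x] by (simp add: G_def norm_mult mult_right_mono)
      also have "\<dots> \<le> (B\<^sup>2 * (cmod (f x))\<^sup>2 + (cmod (e x))\<^sup>2) / 2"
        using sum_squares_bound[of "B * cmod (f x)" "cmod (e x)"] by (simp add: power_mult_distrib)
      finally show ?thesis .
    qed
  qed (use intG in simp)
  also have "\<dots> = (B\<^sup>2 * (\<Sum>j\<in>J. (cmod (u j))\<^sup>2) + S) / 2"
    using hermite_basis_Parseval[OF h I, of c] hermite_basis_Parseval[OF h J, of u]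
    by (simp add: f_def e_def S_def)
  finally show ?thesis by (simp add: S_def c_def)
qed

text \<open>Only entries with positive indices are prescribed, so the result applies to the
  potential matrix, to its derivative and to the remainder, whatever their values at index
  0.\<close>

lemma multiplication_bounded_mats:
  fixes W :: "real \<Rightarrow> complex" and M :: inf_matrix
  assumes h: "hermite_basis h" and W: "W \<in> borel_measurable borel" and B: "\<And>x. cmod (W x) \<le> B"
    and M: "\<And>i j. i \<ge> 1 \<Longrightarrow> j \<ge> 1 \<Longrightarrow> M i j = (LINT x|lborel. (h i x * h j x) *\<^sub>R W x)"
  shows "M \<in> bounded_mats" "0 \<le> op_norm M" "op_norm M \<le> B"
proof -
  have "B \<ge> 0" using B[of 0] norm_ge_zero order_trans by blast
  note * = bounded_mats_if_sections[OF this multiplication_sections_le[OF h W B M]]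
  show "M \<in> bounded_mats" "0 \<le> op_norm M" "op_norm M \<le> B"
    by (rule *; assumption)+
qed

lemma weighted_mats_if_entries_le:
  assumes "\<And>i j. i \<ge> 1 \<Longrightarrow> j \<ge> 1 \<Longrightarrow> cmod (A i j) \<le> K * real (min i j) powr (- \<alpha>)"
  shows "A \<in> weighted_mats \<alpha>" "0 \<le> weighted_norm \<alpha> A" "weighted_norm \<alpha> A \<le> K"
proof -
  have le_K: "y \<le> K" if "y \<in> weighted_entries \<alpha> A" for y
  proof -
    obtain i j where ij: "i \<ge> 1" "j \<ge> 1" "y = real (min i j) powr \<alpha> * cmod (A i j)"
      using \<open>y \<in> weighted_entries \<alpha> A\<close> unfolding weighted_entries_def by blast
    have "y \<le> real (min i j) powr \<alpha> * (K * real (min i j) powr (- \<alpha>))"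
      unfolding ij(3) using assms ij by (intro mult_left_mono) auto
    also have "\<dots> = K" using ij by (simp add: powr_minus)
    finally show ?thesis .
  qed
  have ne: "real (min 1 1) powr \<alpha> * cmod (A 1 1) \<in> weighted_entries \<alpha> A"
    unfolding weighted_entries_def by blast
  have bdd: "bdd_above (weighted_entries \<alpha> A)" using le_K by (rule bdd_aboveI)
  then show "A \<in> weighted_mats \<alpha>" by (simp add: weighted_mats_def)
  show "weighted_norm \<alpha> A \<le> K" unfolding weighted_norm_def
    using ne le_K by (intro cSup_least) auto
  show "0 \<le> weighted_norm \<alpha> A" unfolding weighted_norm_def
    by (rule cSup_upper2[OF ne _ bdd]) simp
qed

section \<open>Analyticity of the matrix\<close>

text \<open>Converts the quadratic remainders given by the Cauchy estimates into Frechet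
  differentiability.\<close>

lemma tendsto_0_if_quadratic:
  fixes g :: "'a :: real_normed_vector \<Rightarrow> real"
  assumes d: "d > 0" and g: "\<And>v. norm v \<le> d \<Longrightarrow> \<bar>g v\<bar> \<le> K * (norm v)\<^sup>2"
  shows "((\<lambda>v. g v / norm v) \<longlongrightarrow> 0) (at 0)"
proof (rule Lim_null_comparison)
  have "\<forall>\<^sub>F v in at 0. norm (v :: 'a) \<le> d"
    using d by (auto simp: eventually_at dist_norm intro!: exI[of _ d])
  then show "\<forall>\<^sub>F v in at 0. norm (g v / norm v) \<le> K * norm v"
  proof eventually_elim
    case (elim v)
    then show ?case
      using g[OF elim] by (cases "v = 0") (simp_all add: field_simps power2_eq_square)
  qed
  show "((\<lambda>v :: 'a. K * norm v) \<longlongrightarrow> 0) (at 0)"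
    using tendsto_mult_right_zero[OF tendsto_norm_zero[OF tendsto_ident_at[of "0 :: 'a" UNIV]], of K] by simp
qed

lemma linear_if_complex_linear:
  fixes L :: "complex ^ 'n \<Rightarrow> complex"
  assumes "\<And>v w. L (v + w) = L v + L w" "\<And>c v. L (c *s v) = c * L v"
  shows "linear L"
proof (rule linearI)
  fix r and v :: "complex ^ 'n"
  have "r *\<^sub>R v = complex_of_real r *s v" by (simp add: vec_eq_iff scaleR_conv_of_real[where 'a=complex])
  then show "L (r *\<^sub>R v) = r *\<^sub>R L v" using assms by (simp add: scaleR_conv_of_real)
qed (rule assms)

lemma has_derivative_if_quadratic_remainder:
  fixes f L :: "complex ^ 'n \<Rightarrow> complex"
  assumes L: "\<And>v w. L (v + w) = L v + L w" "\<And>c v. L (c *s v) = c * L v"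
    and d: "d > 0" and le: "\<And>v. norm v \<le> d \<Longrightarrow> cmod (f (\<theta> + v) - f \<theta> - L v) \<le> K * (norm v)\<^sup>2"
  shows "(f has_derivative L) (at \<theta>)"
  unfolding has_derivative_at
  using linear_if_complex_linear[OF L] tendsto_0_if_quadratic[OF d, of "\<lambda>v. cmod (f (\<theta> + v) - f \<theta> - L v)" K] le
  by (simp add: linear_conv_bounded_linear)

theorem lemma2p6:
  fixes \<sigma> \<delta> C\<^sub>0 :: real
    and h :: "nat \<Rightarrow> real \<Rightarrow> real"
    and V :: "real \<Rightarrow> real ^ 'n \<Rightarrow> real"
    and Vc :: "real \<Rightarrow> complex ^ 'n \<Rightarrow> complex"
  assumes "hermite_basis h"
    and "\<sigma> > 0" and "0 < \<delta>" and "\<delta> < 1" and "C\<^sub>0 > 0"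
    and "C1_function (\<lambda>(x, \<theta>). V x \<theta>)"
    and "\<And>x. analytic_extension \<sigma> (V x) (Vc x)"
    and "\<And>x \<theta>. \<theta> \<in> strip \<sigma> \<Longrightarrow> cmod (Vc x \<theta>) \<le> C\<^sub>0"
    and "\<And>x \<theta>. \<theta> \<in> strip \<sigma> \<Longrightarrow> (\<lambda>y. Vc y \<theta>) differentiable (at x)"
    and "\<And>x \<theta>. \<theta> \<in> strip \<sigma> \<Longrightarrow>
           cmod (vector_derivative (\<lambda>y. Vc y \<theta>) (at x)) \<le> C\<^sub>0 * (1 + \<bar>x\<bar>) powr \<delta>"
  shows "(\<forall>\<theta>\<in>strip \<sigma>. \<forall>i\<ge>1. \<forall>j\<ge>1. integrable lborel (\<lambda>x. (h i x * h j x) *\<^sub>R Vc x \<theta>)) \<and>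
         real_analytic_into \<sigma> (hat_mats ((1 - \<delta>) / 2)) (hat_norm ((1 - \<delta>) / 2))
           (potential_matrix h V) (potential_matrix h Vc)"
proof -
  note h = assms(1)
  define \<alpha> where "\<alpha> = (1 - \<delta>) / 2"
  define P where "P = potential_matrix h Vc"
  have P_def': "P \<theta> i j = (LINT x|lborel. (h i x * h j x) *\<^sub>R Vc x \<theta>)" for \<theta> i j
    by (simp add: P_def potential_matrix_def)
  have deriv_x: "((\<lambda>y. Vc y \<theta>) has_vector_derivative vector_derivative (\<lambda>y. Vc y \<theta>) (at x)) (at x)"
    if "\<theta> \<in> strip \<sigma>" for \<theta> x
    using assms(9)[OF that] by (simp add: vector_derivative_works)
  have Vc_meas: "(\<lambda>x. Vc x \<theta>) \<in> borel_measurable borel" if "\<theta> \<in> strip \<sigma>" for \<theta>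
    using deriv_x[OF that]
    by (intro borel_measurable_continuous_onI)
       (meson continuous_at_imp_continuous_on has_vector_derivative_continuous)
  have hol: "\<exists>f'. (Vc x has_derivative f') (at \<theta>) \<and> (\<forall>c v. f' (c *s v) = c * f' v)" if "\<theta> \<in> strip \<sigma>" for x \<theta>
    using assms(7)[of x] that unfolding analytic_extension_def holomorphic_Cn_def by blast
  \<comment> \<open>The derivative is selected separately for each \<open>x\<close>; its
    measurability in \<open>x\<close> is established below from difference quotients.\<close>
  define D where "D x \<theta> = (SOME f'. (Vc x has_derivative f') (at \<theta>) \<and> (\<forall>c v. f' (c *s v) = c * f' v))" for x \<theta>
  have D: "(Vc x has_derivative D x \<theta>) (at \<theta>)" "D x \<theta> (c *s v) = c * D x \<theta> v" if "\<theta> \<in> strip \<sigma>" for x \<theta> c v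
    using someI_ex[OF hol[OF that, of x]] unfolding D_def by auto
  have D_add: "D x \<theta> (v + w) = D x \<theta> v + D x \<theta> w" if "\<theta> \<in> strip \<sigma>" for x \<theta> v w
    using D(1)[OF that] has_derivative_linear linear_add by blast
  \<comment> \<open>\<open>h 0\<close> is arbitrary, so linearity in \<open>v\<close> of the entries with an index 0 has to be forced.\<close>
  define L where "L \<theta> v i j =
      (if i \<ge> 1 \<and> j \<ge> 1 then (LINT x|lborel. (h i x * h j x) *\<^sub>R D x \<theta> v) else 0)" for \<theta> v i j
  note bounded = hermite_basis_mult_bounded[OF h]
  have int: "integrable lborel (\<lambda>x. (h i x * h j x) *\<^sub>R Vc x \<theta>)" if "\<theta> \<in> strip \<sigma>" "i \<ge> 1" "j \<ge> 1" for \<theta> i j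
    by (rule bounded(1)[OF that(2,3) Vc_meas assms(8)]) (use that in auto)
  \<comment> \<open>Uniformity over the strip lets this bound serve as the supremum in Cauchy
    estimates for the individual entries.\<close>
  have diff_le: "cmod (diff_mat (P \<theta>) i j) \<le> 8 * C\<^sub>0 * real (min i j) powr (- \<alpha>)"
    if "\<theta> \<in> strip \<sigma>" "i \<ge> 1" "j \<ge> 1" for \<theta> i j
    using diff_potential_entry_le[OF h that(2,3) _ _ deriv_x[OF that(1)]
        assms(8)[OF that(1)] _ assms(10)[OF that(1)]]
      assms(3-5) by (simp add: diff_mat_def P_def' \<alpha>_def)
  \<comment> \<open>The constants are independent of \<open>x\<close>, so these bounds can be used
    under the integral.\<close>
  have est: "cmod (D x \<theta> v) \<le> 2 * C\<^sub>0 / r * norm v"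
    "norm v \<le> r / 2 \<Longrightarrow> cmod (Vc x (\<theta> + v) - Vc x \<theta> - D x \<theta> v) \<le> 32 * C\<^sub>0 / r\<^sup>2 * (norm v)\<^sup>2"
    if r: "r > 0" "ball \<theta> r \<subseteq> strip \<sigma>" for x \<theta> v r
  proof -
    have "\<theta> \<in> strip \<sigma>" using r by auto
    then show "cmod (D x \<theta> v) \<le> 2 * C\<^sub>0 / r * norm v"
      "norm v \<le> r / 2 \<Longrightarrow> cmod (Vc x (\<theta> + v) - Vc x \<theta> - D x \<theta> v) \<le> 32 * C\<^sub>0 / r\<^sup>2 * (norm v)\<^sup>2"
      using r by (intro Cauchy_estimates_Cn[OF hol assms(8) r(1) D(1)]; auto)+
  qed
  have in_strip: "\<theta> + v \<in> strip \<sigma>" if "r > 0" "ball \<theta> r \<subseteq> strip \<sigma>" "norm v \<le> r / 2" for \<theta> v r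
    using that by (auto simp: subset_iff dist_norm)
  have D_meas: "(\<lambda>x. D x \<theta> v) \<in> borel_measurable borel" if r: "r > 0" "ball \<theta> r \<subseteq> strip \<sigma>" for \<theta> v r
  proof -
    have \<theta>: "\<theta> \<in> strip \<sigma>" using r by auto
    \<comment> \<open>The steps tend to 0 and keep the displacement within \<open>r / 2\<close>; the
      summand 1 covers \<open>v = 0\<close>.\<close>
    define t where "t n = r / (2 * (norm v + 1)) / real (Suc n)" for n
    have t: "t n > 0" for n using r by (simp add: t_def add_nonneg_pos)
    have t_le: "norm (complex_of_real (t n) *s v) \<le> r / 2" for n
    proof -
      have "t n \<le> r / (2 * (norm v + 1)) / 1"
        unfolding t_def using r by (intro divide_left_mono) (auto simp: add_nonneg_pos)
      then have "t n * norm v \<le> r / (2 * (norm v + 1)) * (norm v + 1)"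
        using r by (intro mult_mono) (auto simp: add_nonneg_pos)
      also have "\<dots> = r / 2" by (simp add: field_simps add_nonneg_eq_0_iff)
      finally show ?thesis using t[of n] by (simp add: norm_vector_scalar_mult)
    qed
    show ?thesis
    proof (rule borel_measurable_LIMSEQ_metric)
      show "(\<lambda>x. (Vc x (\<theta> + complex_of_real (t n) *s v) - Vc x \<theta>) / of_real (t n)) \<in> borel_measurable borel" for n
        using Vc_meas[OF in_strip[OF r t_le]] Vc_meas[OF \<theta>] by measurable
      fix x
      have le: "cmod ((Vc x (\<theta> + complex_of_real (t n) *s v) - Vc x \<theta>) / of_real (t n) - D x \<theta> v)
          \<le> 32 * C\<^sub>0 / r\<^sup>2 * (norm v)\<^sup>2 * t n" for n
      proof -
        have "(Vc x (\<theta> + complex_of_real (t n) *s v) - Vc x \<theta>) / of_real (t n) - D x \<theta> v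
            = (Vc x (\<theta> + complex_of_real (t n) *s v) - Vc x \<theta>
                - D x \<theta> (complex_of_real (t n) *s v)) / of_real (t n)"
          using t[of n] by (simp add: D(2)[OF \<theta>] field_simps)
        also have "cmod \<dots> \<le> 32 * C\<^sub>0 / r\<^sup>2 * (norm (complex_of_real (t n) *s v))\<^sup>2 / t n"
          using divide_right_mono[OF est(2)[OF r t_le, of x n], of "t n"] t[of n] by (simp add: norm_divide)
        also have "\<dots> = 32 * C\<^sub>0 / r\<^sup>2 * (norm v)\<^sup>2 * t n"
          using t[of n] by (simp add: norm_vector_scalar_mult power_mult_distrib power2_eq_square)
        finally show ?thesis .
      qed
      have "t \<longlonglongrightarrow> 0"
        unfolding t_def[abs_def] by (rule LIMSEQ_Suc[OF lim_const_over_n])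
      then have lim: "(\<lambda>n. 32 * C\<^sub>0 / r\<^sup>2 * (norm v)\<^sup>2 * t n) \<longlonglongrightarrow> 0"
        by (rule tendsto_mult_right_zero)
      have "(\<lambda>n. (Vc x (\<theta> + complex_of_real (t n) *s v) - Vc x \<theta>) / of_real (t n) - D x \<theta> v) \<longlonglongrightarrow> 0"
        by (rule Lim_null_comparison[OF always_eventually lim]) (intro allI le)
      then show "(\<lambda>n. (Vc x (\<theta> + complex_of_real (t n) *s v) - Vc x \<theta>) / of_real (t n)) \<longlonglongrightarrow> D x \<theta> v"
        by (rule LIM_zero_cancel)
    qed
  qed
  have D_int: "integrable lborel (\<lambda>x. (h i x * h j x) *\<^sub>R D x \<theta> v)" if "\<theta> \<in> strip \<sigma>" "i \<ge> 1" "j \<ge> 1" for \<theta> v i j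
  proof -
    obtain r where r: "r > 0" "ball \<theta> r \<subseteq> strip \<sigma>" using strip_contains_ball[OF \<open>\<theta> \<in> strip \<sigma>\<close>] by blast
    show ?thesis by (rule bounded(1)[OF that(2,3) D_meas[OF r] est(1)[OF r]])
  qed
  have L_add: "L \<theta> (v + w) = (\<lambda>i j. L \<theta> v i j + L \<theta> w i j)" if "\<theta> \<in> strip \<sigma>" for \<theta> v w
    using D_int[OF that] by (auto simp: L_def fun_eq_iff D_add[OF that] scaleR_add_right)
  have L_scale: "L \<theta> (c *s v) = (\<lambda>i j. c * L \<theta> v i j)" if "\<theta> \<in> strip \<sigma>" for \<theta> c v
  proof -
    have "(\<lambda>x. (h i x * h j x) *\<^sub>R D x \<theta> (c *s v)) = (\<lambda>x. c * ((h i x * h j x) *\<^sub>R D x \<theta> v))" for i j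
      by (simp add: D(2)[OF that] fun_eq_iff)
    then show ?thesis by (auto simp only: L_def fun_eq_iff integral_mult_right_zero split: if_splits) auto
  qed
  \<comment> \<open>The remainder of the matrix map is itself the matrix of multiplication by
    \<open>R\<close>, so its operator norm is controlled by the supremum of
    \<open>R\<close>.\<close>
  define R where "R \<theta> v x = Vc x (\<theta> + v) - Vc x \<theta> - D x \<theta> v" for \<theta> v x
  have R_eq: "P (\<theta> + v) i j - P \<theta> i j - L \<theta> v i j = (LINT x|lborel. (h i x * h j x) *\<^sub>R R \<theta> v x)"
    if "\<theta> \<in> strip \<sigma>" "\<theta> + v \<in> strip \<sigma>" "i \<ge> 1" "j \<ge> 1" for \<theta> v i j
    using int[OF that(1,3,4)] int[OF that(2,3,4)] D_int[OF that(1,3,4), of v] that(3,4)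
    by (simp add: P_def' L_def R_def scaleR_diff_right)
  have R_meas: "R \<theta> v \<in> borel_measurable borel" if "r > 0" "ball \<theta> r \<subseteq> strip \<sigma>" "norm v \<le> r / 2" for \<theta> v r
  proof -
    have "\<theta> \<in> strip \<sigma>" using that by auto
    then show ?thesis
      unfolding R_def[abs_def] using Vc_meas[OF in_strip[OF that]] Vc_meas D_meas[OF that(1,2)] by measurable
  qed
  \<comment> \<open>The constant here may depend on \<open>i\<close> and \<open>j\<close>: the aim
    is to identify the derivative of each entry, while uniform bounds come from the Cauchy
    estimates.\<close>
  have P_deriv: "((\<lambda>\<theta>. P \<theta> i j) has_derivative (\<lambda>v. L \<theta> v i j)) (at \<theta>)"
    if \<theta>: "\<theta> \<in> strip \<sigma>" and ij: "i \<ge> 1" "j \<ge> 1" for \<theta> i j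
  proof -
    obtain r where r: "r > 0" "ball \<theta> r \<subseteq> strip \<sigma>" using strip_contains_ball[OF \<theta>] by blast
    show ?thesis
    proof (rule has_derivative_if_quadratic_remainder)
      show "r / 2 > 0" using r by simp
      fix v :: "complex ^ 'n" assume v: "norm v \<le> r / 2"
      have "cmod (P (\<theta> + v) i j - P \<theta> i j - L \<theta> v i j)
          \<le> 32 * C\<^sub>0 / r\<^sup>2 * (norm v)\<^sup>2 * (LINT x|lborel. \<bar>h i x * h j x\<bar>)"
        unfolding R_eq[OF \<theta> in_strip[OF r v] ij]
        by (rule bounded(2)[OF ij R_meas[OF r v]]) (simp only: R_def est(2)[OF r v])
      then show "cmod (P (\<theta> + v) i j - P \<theta> i j - L \<theta> v i j)
          \<le> 32 * C\<^sub>0 / r\<^sup>2 * (LINT x|lborel. \<bar>h i x * h j x\<bar>) * (norm v)\<^sup>2"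
        by (simp add: mult_ac)
    qed (simp_all add: L_add[OF \<theta>] L_scale[OF \<theta>])
  qed
  have diff_deriv: "((\<lambda>\<theta>. diff_mat (P \<theta>) i j) has_derivative (\<lambda>v. diff_mat (L \<theta> v) i j)) (at \<theta>)"
    if "\<theta> \<in> strip \<sigma>" "i \<ge> 1" "j \<ge> 1" for \<theta> i j
    unfolding diff_mat_def by (intro has_derivative_diff P_deriv that) auto
  have diff_hol: "\<exists>f'. ((\<lambda>\<theta>. diff_mat (P \<theta>) i j) has_derivative f') (at \<theta>) \<and> (\<forall>c v. f' (c *s v) = c * f' v)"
    if "\<theta> \<in> strip \<sigma>" "i \<ge> 1" "j \<ge> 1" for \<theta> i j
    using diff_deriv[OF that]
    by (intro exI[of _ "\<lambda>v. diff_mat (L \<theta> v) i j"])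
       (simp add: diff_mat_def L_scale[OF that(1)] right_diff_distrib)
  have P_mem: "P \<theta> \<in> hat_mats \<alpha>" if "\<theta> \<in> strip \<sigma>" for \<theta>
  proof -
    have "P \<theta> \<in> bounded_mats"
      by (rule multiplication_bounded_mats(1)[OF h Vc_meas[OF that] assms(8)[OF that] P_def'])
    then show ?thesis
      using weighted_mats_if_entries_le(1)[OF diff_le[OF that]] by (simp add: hat_mats_def)
  qed
  have "analytic_into (hat_mats \<alpha>) (hat_norm \<alpha>) P (strip \<sigma>)"
    unfolding analytic_into_def
  proof (intro conjI ballI)
    fix \<theta> :: "complex ^ 'n" assume \<theta>: "\<theta> \<in> strip \<sigma>"
    show "P \<theta> \<in> hat_mats \<alpha>" using \<theta> by (rule P_mem)
    obtain r where r: "r > 0" "ball \<theta> r \<subseteq> strip \<sigma>" using strip_contains_ball[OF \<theta>] by blast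
    \<comment> \<open>The decay in \<open>i\<close> and \<open>j\<close> sits in the supremum bound
      of each scalar entry, and the Cauchy estimates pass it on to the derivative and to the
      remainder.\<close>
    have diff_est: "cmod (diff_mat (L \<theta> v) i j) \<le> 2 * (8 * C\<^sub>0 * real (min i j) powr (- \<alpha>)) / r * norm v"
      "norm v \<le> r / 2 \<Longrightarrow> cmod (diff_mat (P (\<theta> + v)) i j - diff_mat (P \<theta>) i j - diff_mat (L \<theta> v) i j)
        \<le> 32 * (8 * C\<^sub>0 * real (min i j) powr (- \<alpha>)) / r\<^sup>2 * (norm v)\<^sup>2"
      if "i \<ge> 1" "j \<ge> 1" for i j v
      using r(2)
      by (intro Cauchy_estimates_Cn[OF diff_hol[OF _ that] diff_le[OF _ that] r(1) diff_deriv[OF \<theta> that]]; auto)+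
    have L_mem: "L \<theta> v \<in> hat_mats \<alpha>" for v
    proof -
      have "L \<theta> v \<in> bounded_mats"
        by (rule multiplication_bounded_mats(1)[OF h D_meas[OF r] est(1)[OF r]]) (simp add: L_def)
      moreover have "diff_mat (L \<theta> v) \<in> weighted_mats \<alpha>"
        by (rule weighted_mats_if_entries_le(1)[where K="16 * C\<^sub>0 / r * norm v"])
           (use diff_est(1) in \<open>simp add: mult_ac\<close>)
      ultimately show ?thesis by (simp add: hat_mats_def)
    qed
    \<comment> \<open>The constant \<open>256 = 32 * 8\<close> comes from the weighted part and also
      dominates the 32 of the operator norm; nonnegativity of both parts removes the absolute
      value.\<close>
    have N: "\<bar>hat_norm \<alpha> (\<lambda>i j. P (\<theta> + v) i j - P \<theta> i j - L \<theta> v i j)\<bar> \<le> 256 * C\<^sub>0 / r\<^sup>2 * (norm v)\<^sup>2"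
      if v: "norm v \<le> r / 2" for v
    proof -
      let ?A = "\<lambda>i j. P (\<theta> + v) i j - P \<theta> i j - L \<theta> v i j"
      have nonneg: "0 \<le> C\<^sub>0 / r\<^sup>2 * (norm v)\<^sup>2" using assms(5) by simp
      have R_le: "cmod (R \<theta> v x) \<le> 32 * C\<^sub>0 / r\<^sup>2 * (norm v)\<^sup>2" for x
        unfolding R_def by (rule est(2)[OF r v])
      note mult = multiplication_bounded_mats[OF h R_meas[OF r v] R_le R_eq[OF \<theta> in_strip[OF r v]]]
      have "0 \<le> op_norm ?A" by (rule mult(2))
      moreover have "op_norm ?A \<le> 32 * C\<^sub>0 / r\<^sup>2 * (norm v)\<^sup>2" by (rule mult(3))
      moreover have "0 \<le> weighted_norm \<alpha> (diff_mat ?A)"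
        "weighted_norm \<alpha> (diff_mat ?A) \<le> 256 * C\<^sub>0 / r\<^sup>2 * (norm v)\<^sup>2"
      proof -
        have entry: "cmod (diff_mat ?A i j) \<le> 256 * C\<^sub>0 / r\<^sup>2 * (norm v)\<^sup>2 * real (min i j) powr (- \<alpha>)"
          if "i \<ge> 1" "j \<ge> 1" for i j
          using diff_est(2)[OF that v] by (simp add: diff_mat_def algebra_simps)
        show "0 \<le> weighted_norm \<alpha> (diff_mat ?A)"
        "weighted_norm \<alpha> (diff_mat ?A) \<le> 256 * C\<^sub>0 / r\<^sup>2 * (norm v)\<^sup>2"
          using weighted_mats_if_entries_le(2,3)[OF entry] by auto
      qed
      ultimately show ?thesis using nonneg by (simp add: hat_norm_def)
    qed
    show "\<exists>L. (\<forall>v. L v \<in> hat_mats \<alpha>) \<and> (\<forall>v w. L (v + w) = (\<lambda>i j. L v i j + L w i j)) \<and>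
        (\<forall>c v. L (c *s v) = (\<lambda>i j. c * L v i j)) \<and>
        ((\<lambda>v. hat_norm \<alpha> (\<lambda>i j. P (\<theta> + v) i j - P \<theta> i j - L v i j) / norm v) \<longlongrightarrow> 0) (at 0)"
    proof (intro exI[of _ "L \<theta>"] conjI allI L_mem L_add[OF \<theta>] L_scale[OF \<theta>])
      show "((\<lambda>v. hat_norm \<alpha> (\<lambda>i j. P (\<theta> + v) i j - P \<theta> i j - L \<theta> v i j) / norm v) \<longlongrightarrow> 0) (at 0)"
        by (rule tendsto_0_if_quadratic[where d="r / 2", OF _ N]) (use r in simp_all)
    qed
  qed
  moreover have "torus_periodic UNIV (potential_matrix h V)"
    using assms(7) by (simp add: torus_periodic_def potential_matrix_def analytic_extension_def fun_eq_iff)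
  moreover have "torus_periodic (strip \<sigma>) P"
    using assms(7) by (simp add: torus_periodic_def P_def potential_matrix_def analytic_extension_def fun_eq_iff)
  moreover have "P (complexify \<theta>) i j = complex_of_real (potential_matrix h V \<theta> i j)" for \<theta> i j
  proof -
    have "Vc x (complexify \<theta>) = complex_of_real (V x \<theta>)" for x
      using assms(7)[of x] by (simp add: analytic_extension_def)
    then have "P (complexify \<theta>) i j = (LINT x|lborel. complex_of_real (h i x * h j x * V x \<theta>))"
      by (simp add: P_def' scaleR_conv_of_real)
    also have "\<dots> = complex_of_real (LINT x|lborel. h i x * h j x * V x \<theta>)"
      by (rule integral_complex_of_real)
    finally show ?thesis by (simp add: potential_matrix_def)
  qed
  ultimately show ?thesis
    using int by (simp add: real_analytic_into_def P_def \<alpha>_def)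
qed

end
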